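(* Let $(B,C)$ and $(X,A)$ be CW pairs, let $f\colon (B,C)\to (X,A)$ be a map of pairs, and let $f^*\colon H^*(X,A)\to H^*(B,C)$ be the induced homomorphism in cohomology. Then $$\operatorname{nil}(\operatorname{Im}(f^* ))\le \operatorname{srelcat}(f).$$
   Context: All maps are continuous and $I=[0,1]$. $H^*$ denotes singular cohomology with coefficients in a fixed commutative ring with unity, and $H^*(B,C)$ is a (not necessarily unital) ring under the relative cup product. Nilpotency index: for a (graded-)commutative, possibly non-unital, ring $R$, $\operatorname{nil}(R)$ is the non-negative integer $n$ such that $R^n\neq 0$ but $R^{n+1}=0$ (where $R^m$ is generated by the products of $m$ elements of $R$; $\operatorname{nil}(0)=0$). Thus $\operatorname{nil}(R)\le k$ means that every product of $k+1$ elements of $R$ vanishes. A map of pairs $g\colon (B,C)\to (X,A)$ is strongly relatively inessential if there is a homotopy $H\colon B\times I\to X$ such that $H(-,1)=g$, $H(B,0)\subseteq A$, and $H(c,t)=g(c)\in A$ for all $c\in C$ and $t\in I$. Strong relative category of a map: for a map of pairs $f\colon (B,C)\to (X,A)$, $\operatorname{srelcat}(f)$ is the least non-negative integer $\ell$ such that $B$ has an open cover $\{B_0,\dots,B_\ell\}$ for which each restriction $f|_{B_i}\colon (B_i,B_i\cap C)\to (X,A)$ is strongly relatively inessential. If no such $\ell$ exists, $\operatorname{srelcat}(f)=\infty$. *)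

theory Defs
  imports
    "HOL-Library.Extended_Nat"
    "HOL-Algebra.QuotRing"
    "HOL-Algebra.Generated_Groups"
    "HOL-Homology.Homology"
begin

section \<open>CW pairs\<close>

definition disc :: "nat \<Rightarrow> (nat \<Rightarrow> real) topology" where
  "disc n = subtopology (Euclidean_space n) {x. (\<Sum>i<n. (x i)\<^sup>2) \<le> 1}"

definition disc_interior :: "nat \<Rightarrow> (nat \<Rightarrow> real) set" where
  "disc_interior n = {x \<in> topspace (disc n). (\<Sum>i<n. (x i)\<^sup>2) < 1}"

definition disc_boundary :: "nat \<Rightarrow> (nat \<Rightarrow> real) set" where
  "disc_boundary n = {x \<in> topspace (disc n). (\<Sum>i<n. (x i)\<^sup>2) = 1}"

text \<open>\<open>E n\<close> is the set of open \<open>n\<close>-cells. The clause on the images of the boundary spheres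
  combines the condition on dimensions with closure-finiteness; the last clause says that \<open>X\<close>
  carries the weak topology.\<close>

definition cw_structure :: "'a topology \<Rightarrow> (nat \<Rightarrow> 'a set set) \<Rightarrow> bool" where
  "cw_structure X E \<longleftrightarrow>
     Hausdorff_space X \<and>
     topspace X = (\<Union>n. \<Union>(E n)) \<and>
     (\<forall>m n. \<forall>d\<in>E m. \<forall>e\<in>E n. (m, d) \<noteq> (n, e) \<longrightarrow> d \<inter> e = {}) \<and>
     (\<forall>n. \<forall>e\<in>E n. \<exists>\<Phi>.
        continuous_map (disc n) X \<Phi> \<and>
        homeomorphic_map (subtopology (disc n) (disc_interior n)) (subtopology X e) \<Phi> \<and>
        (\<exists>F. finite F \<and> F \<subseteq> (\<Union>m<n. E m) \<and> \<Phi> ` disc_boundary n \<subseteq> \<Union>F)) \<and>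
     (\<forall>S. S \<subseteq> topspace X \<longrightarrow>
        (closedin X S \<longleftrightarrow> (\<forall>n. \<forall>e\<in>E n. closedin X (S \<inter> X closure_of e))))"

definition cw_pair :: "'a topology \<Rightarrow> 'a set \<Rightarrow> bool" where
  "cw_pair X A \<longleftrightarrow>
     (\<exists>E. cw_structure X E \<and>
        (\<exists>F. (\<forall>n. F n \<subseteq> E n) \<and> A = (\<Union>n. \<Union>(F n)) \<and> (\<forall>n. \<forall>e\<in>F n. X closure_of e \<subseteq> A)))"

definition map_of_pairs ::
    "'b topology \<Rightarrow> 'b set \<Rightarrow> 'a topology \<Rightarrow> 'a set \<Rightarrow> ('b \<Rightarrow> 'a) \<Rightarrow> bool" where
  "map_of_pairs B C X A f \<longleftrightarrow> continuous_map B X f \<and> f ` C \<subseteq> A"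


section \<open>Singular cohomology of a pair as a graded ring\<close>

text \<open>A family \<open>\<phi> :: ('a, 'r) cochain\<close> has as its degree \<open>n\<close> component the function \<open>\<phi> n\<close> on
  singular \<open>n\<close>-simplices. The coefficient sort \<open>{comm_ring, monoid_mult}\<close> used below is that of
  commutative rings with unity; unlike \<open>comm_ring_1\<close> it does not exclude the zero ring.\<close>

type_synonym ('a, 'r) cochain = "nat \<Rightarrow> ((nat \<Rightarrow> real) \<Rightarrow> 'a) \<Rightarrow> 'r"

text \<open>The direct sum over all degrees of the groups \<open>C\<^sup>n(X, A)\<close> of cochains on \<open>X\<close> that vanish on
  the simplices of \<open>A\<close>; as functions on all of \<open>(nat \<Rightarrow> real) \<Rightarrow> 'a\<close> they are made canonical by
  being zero off the singular simplices of \<open>X\<close>.\<close>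

definition rel_cochains :: "'a topology \<Rightarrow> 'a set \<Rightarrow> ('a, 'r::{comm_ring,monoid_mult}) cochain set"
  where
  "rel_cochains X A =
     {\<phi>. (\<forall>n \<sigma>. \<not> singular_simplex n X \<sigma> \<longrightarrow> \<phi> n \<sigma> = 0) \<and>
         (\<forall>n \<sigma>. singular_simplex n (subtopology X A) \<sigma> \<longrightarrow> \<phi> n \<sigma> = 0) \<and>
         finite {n. \<phi> n \<noteq> (\<lambda>\<sigma>. 0)}}"

definition coboundary ::
    "'a topology \<Rightarrow> ('a, 'r::{comm_ring,monoid_mult}) cochain \<Rightarrow> ('a, 'r) cochain" where
  "coboundary X \<phi> = (\<lambda>n \<sigma>.
     if 0 < n \<and> singular_simplex n X \<sigma>
     then \<Sum>k\<le>n. (- 1) ^ k * \<phi> (n - 1) (singular_face n k \<sigma>) else 0)"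

definition rel_cocycles :: "'a topology \<Rightarrow> 'a set \<Rightarrow> ('a, 'r::{comm_ring,monoid_mult}) cochain set"
  where
  "rel_cocycles X A = {\<phi> \<in> rel_cochains X A. coboundary X \<phi> = (\<lambda>n \<sigma>. 0)}"

definition rel_coboundaries ::
    "'a topology \<Rightarrow> 'a set \<Rightarrow> ('a, 'r::{comm_ring,monoid_mult}) cochain set" where
  "rel_coboundaries X A = coboundary X ` rel_cochains X A"

text \<open>The faces of an \<open>(i + j)\<close>-simplex \<open>\<sigma>\<close> spanned by the vertices \<open>0, \<dots>, i\<close> and
  \<open>i, \<dots>, i + j\<close>. Recall that \<open>standard_simplex i \<subseteq> standard_simplex (i + j)\<close>.\<close>

definition front_face :: "nat \<Rightarrow> ((nat \<Rightarrow> real) \<Rightarrow> 'a) \<Rightarrow> (nat \<Rightarrow> real) \<Rightarrow> 'a" where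
  "front_face i \<sigma> = restrict \<sigma> (standard_simplex i)"

definition back_face :: "nat \<Rightarrow> nat \<Rightarrow> ((nat \<Rightarrow> real) \<Rightarrow> 'a) \<Rightarrow> (nat \<Rightarrow> real) \<Rightarrow> 'a" where
  "back_face i j \<sigma> = restrict (\<lambda>x. \<sigma> (\<lambda>k. if k < i then 0 else x (k - i))) (standard_simplex j)"

definition cup ::
    "'a topology \<Rightarrow> ('a, 'r::{comm_ring,monoid_mult}) cochain \<Rightarrow> ('a, 'r) cochain \<Rightarrow> ('a, 'r) cochain"
  where
  "cup X \<phi> \<psi> = (\<lambda>n \<sigma>.
     if singular_simplex n X \<sigma>
     then \<Sum>i\<le>n. \<phi> i (front_face i \<sigma>) * \<psi> (n - i) (back_face i (n - i) \<sigma>) else 0)"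

text \<open>These rings need not be unital. The record type \<open>ring\<close> nevertheless has a field
  \<open>one\<close>, which is left unspecified and plays no role.\<close>

definition cocycle_ring ::
    "'a topology \<Rightarrow> 'a set \<Rightarrow> ('a, 'r::{comm_ring,monoid_mult}) cochain ring" where
  "cocycle_ring X A =
     \<lparr>carrier = rel_cocycles X A, mult = cup X, one = undefined,
      ring.zero = (\<lambda>n \<sigma>. 0), ring.add = (\<lambda>\<phi> \<psi> n \<sigma>. \<phi> n \<sigma> + \<psi> n \<sigma>)\<rparr>"

text \<open>The cochains above are finite sums of homogeneous ones and the coboundary operator is
  homogeneous, so this quotient is the direct sum of the groups \<open>H\<^sup>n(X, A)\<close>.\<close>

definition cohomology_ring ::
    "'a topology \<Rightarrow> 'a set \<Rightarrow> ('a, 'r::{comm_ring,monoid_mult}) cochain set ring" where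
  "cohomology_ring X A = cocycle_ring X A Quot rel_coboundaries X A"

definition cochain_map ::
    "'b topology \<Rightarrow> ('b \<Rightarrow> 'a) \<Rightarrow> ('a, 'r::{comm_ring,monoid_mult}) cochain \<Rightarrow> ('b, 'r) cochain"
  where
  "cochain_map B f \<phi> = (\<lambda>n \<sigma>. if singular_simplex n B \<sigma> then \<phi> n (simplex_map n f \<sigma>) else 0)"

text \<open>As in \<^const>\<open>rcoset_mult\<close>, the union is over all representatives \<open>\<phi>\<close> of the class \<open>u\<close>.\<close>

definition cohomology_map ::
    "'b topology \<Rightarrow> 'b set \<Rightarrow> ('b \<Rightarrow> 'a) \<Rightarrow>
     ('a, 'r::{comm_ring,monoid_mult}) cochain set \<Rightarrow> ('b, 'r) cochain set" where
  "cohomology_map B C f u =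
     (\<Union>\<phi>\<in>u. rel_coboundaries B C +>\<^bsub>cocycle_ring B C\<^esub> cochain_map B f \<phi>)"

definition cohomology_image ::
    "'b topology \<Rightarrow> 'b set \<Rightarrow> 'a topology \<Rightarrow> 'a set \<Rightarrow> ('b \<Rightarrow> 'a) \<Rightarrow>
     ('b, 'r::{comm_ring,monoid_mult}) cochain set ring" where
  "cohomology_image B C X A f =
     cohomology_ring B C \<lparr>carrier := cohomology_map B C f ` carrier (cohomology_ring X A)\<rparr>"


section \<open>Nilpotency index\<close>

text \<open>\<open>R\<^sup>m\<close> for \<open>m > 0\<close>: the additive subgroup generated by the products of \<open>m\<close> elements.\<close>

definition ring_power :: "('a, 'm) ring_scheme \<Rightarrow> nat \<Rightarrow> 'a set" where
  "ring_power R m =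
     generate (add_monoid R)
       {foldl (\<otimes>\<^bsub>R\<^esub>) x xs | x xs. set (x # xs) \<subseteq> carrier R \<and> length (x # xs) = m}"

text \<open>In a ring, at most one \<open>n\<close> satisfies the condition; if there is none, the index is \<open>\<infinity>\<close>. The guard
  \<open>0 < n\<close> gives the zero ring index \<open>0\<close>.\<close>

definition nilpotency_index :: "('a, 'm) ring_scheme \<Rightarrow> enat" where
  "nilpotency_index R =
     Inf {enat n | n. (0 < n \<longrightarrow> ring_power R n \<noteq> {\<zero>\<^bsub>R\<^esub>}) \<and> ring_power R (n + 1) = {\<zero>\<^bsub>R\<^esub>}}"


section \<open>Strong relative category of a map\<close>

definition strongly_relatively_inessential ::
    "'b topology \<Rightarrow> 'b set \<Rightarrow> 'a topology \<Rightarrow> 'a set \<Rightarrow> ('b \<Rightarrow> 'a) \<Rightarrow> bool" where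
  "strongly_relatively_inessential B C X A g \<longleftrightarrow>
     (\<exists>H. continuous_map (prod_topology B (top_of_set {0..1::real})) X H \<and>
          (\<forall>b\<in>topspace B. H (b, 1) = g b) \<and>
          (\<forall>b\<in>topspace B. H (b, 0) \<in> A) \<and>
          (\<forall>c\<in>C. \<forall>t\<in>{0..1}. H (c, t) = g c \<and> g c \<in> A))"

definition srelcat :: "'b topology \<Rightarrow> 'b set \<Rightarrow> 'a topology \<Rightarrow> 'a set \<Rightarrow> ('b \<Rightarrow> 'a) \<Rightarrow> enat" where
  "srelcat B C X A f =
     Inf {enat l | l. \<exists>U :: nat \<Rightarrow> 'b set.
            (\<forall>i\<le>l. openin B (U i)) \<and> (\<Union>i\<le>l. U i) = topspace B \<and>
            (\<forall>i\<le>l. strongly_relatively_inessential (subtopology B (U i)) (U i \<inter> C) X A f)}"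

end

theory Submission
  imports Defs
begin

text \<open>If a homotopy makes \<open>f\<close> strongly relatively inessential on an open set \<open>U\<close>, its prism operator
  yields a cochain \<open>\<psi>\<close> on \<open>U\<close> with \<open>f\<^sup># \<phi> = \<delta> \<psi>\<close> there, for any relative cocycle \<open>\<phi>\<close>. As the homotopy is
  stationary on \<open>U \<inter> C\<close>, \<open>\<psi>\<close> vanishes on the simplices of \<open>U \<inter> C\<close>, so its extension by zero to all
  simplices of \<open>B\<close> is a relative cochain of \<open>(B, C)\<close>. Hence the class of \<open>f\<^sup># \<phi>\<close> has a representative
  that vanishes on all simplices in \<open>U\<close>. With one such representative for each member of the cover,
  the cup product is a relative cocycle vanishing on all simplices that are small with respect to
  the cover, and subdivision shows that it is a relative coboundary.\<close>

text \<open>Extending \<psi> by zero leaves its coboundary uncontrolled on the simplices of B that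
  leave U. This is harmless: the coboundary of a relative cochain never changes the class, and the
  new representative has to vanish only on the simplices inside U. Explicit cochains thereby replace
  the usual passage through the groups of the pairs (B, U_i \<union> C) and the excision needed to
  multiply their classes. The price is paid at the end: a cochain that vanishes on each U_i can
  still be nonzero on a simplex that lies in no single U_i, and it is openness of the cover, through
  iterated subdivision, that closes this gap. Since classes are sums over all degrees, everything is
  done for families of cochains, and degree-dependent signs become operators on such
  families.\<close>

section \<open>Evaluating cochains on chains\<close>

text \<open>Integers act on the coefficients only through the additive group: the sort of the coefficients
  does not provide \<^const>\<open>of_int\<close>. So the extension is taken from the universal property.\<close>

definition chain_eval :: "('s \<Rightarrow> 'r::ab_group_add) \<Rightarrow> ('s \<Rightarrow>\<^sub>0 int) \<Rightarrow> 'r" where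
  "chain_eval u = (SOME h. (\<forall>a b. h (a + b) = h a + h b) \<and> (\<forall>x. h (frag_of x) = u x))"

lemma chain_eval_spec:
  fixes u :: "'s \<Rightarrow> 'r::ab_group_add"
  shows "(\<forall>a b. chain_eval u (a + b) = chain_eval u a + chain_eval u b) \<and>
         (\<forall>x. chain_eval u (frag_of x) = u x)"
proof -
  let ?G = "\<lparr>carrier = UNIV, monoid.mult = (+), one = (0::'r)\<rparr>"
  have "comm_group ?G"
  proof (rule comm_groupI)
    show "\<exists>y\<in>carrier ?G. y \<otimes>\<^bsub>?G\<^esub> x = \<one>\<^bsub>?G\<^esub>" for x
      by (rule bexI [of _ "- x"]) simp_all
  qed (simp_all add: add_ac)
  then obtain h where h: "h \<in> hom (free_Abelian_group UNIV) ?G" "\<And>x. h (frag_of x) = u x"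
    using comm_group.free_Abelian_group_universal [of ?G u UNIV thesis] by simp
  from h(1) have "h (a + b) = h a + h b" for a b
    by (auto simp: hom_def)
  with h(2) have "\<exists>h. (\<forall>a b. h (a + b) = h a + h b) \<and> (\<forall>x. h (frag_of x) = u x)"
    by blast
  from someI_ex [OF this] show ?thesis
    unfolding chain_eval_def .
qed

lemma chain_eval_of [simp]: "chain_eval u (frag_of x) = u x"
  and chain_eval_add: "chain_eval u (a + b) = chain_eval u a + chain_eval u b"
  by (simp_all add: chain_eval_spec)

lemma chain_eval_0 [simp]: "chain_eval u 0 = 0"
  using chain_eval_add [of u 0 0] by simp

lemma chain_eval_minus: "chain_eval u (- a) = - chain_eval u a"
  using chain_eval_add [of u a "- a"] by (simp add: eq_neg_iff_add_eq_0 add.commute)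

lemma chain_eval_diff: "chain_eval u (a - b) = chain_eval u a - chain_eval u b"
  using chain_eval_add [of u a "- b"] by (simp add: chain_eval_minus)

lemma chain_eval_sum: "chain_eval u (sum g I) = (\<Sum>i\<in>I. chain_eval u (g i))"
  by (induction I rule: infinite_finite_induct) (simp_all add: chain_eval_add)

text \<open>The boundary of a simplex has only signs as coefficients, and for these compatibility
  follows from additivity alone: every factor -1 is a negation.\<close>

lemma chain_eval_sign:
  fixes u :: "'s \<Rightarrow> 'r::{comm_ring,monoid_mult}"
  shows "chain_eval u (frag_cmul ((- 1) ^ k) c) = (- 1) ^ k * chain_eval u c"
proof (induction k)
  case (Suc k)
  have "frag_cmul ((- 1) ^ Suc k) c = - frag_cmul ((- 1) ^ k) c"
    by simp
  with Suc show ?case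
    by (simp only: chain_eval_minus) simp
qed simp

lemma chain_eval_eq:
  assumes "\<And>x. x \<in> Poly_Mapping.keys c \<Longrightarrow> u x = v x"
  shows "chain_eval u c = chain_eval v c"
proof -
  have "Poly_Mapping.keys c \<subseteq> {x. u x = v x}"
    using assms by auto
  then show ?thesis
    by (induction rule: frag_induction) (auto simp: chain_eval_diff)
qed

lemma chain_eval_zero_fun [simp]: "chain_eval (\<lambda>x. 0) c = 0"
  using subset_UNIV by (induction c rule: frag_induction) (auto simp: chain_eval_diff)

lemma chain_eval_eq_0: "(\<And>x. x \<in> Poly_Mapping.keys c \<Longrightarrow> u x = 0) \<Longrightarrow> chain_eval u c = 0"
  using chain_eval_eq [of c u "\<lambda>x. 0"] by simp

text \<open>The coboundary is the transpose of the boundary under the pairing of cochains with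
  chains. This turns facts about singular chains, such as the vanishing of the double boundary or
  the subdivision homotopy, into facts about cochains.\<close>

lemma coboundary_chain_eval:
  assumes "singular_chain (Suc n) X c"
  shows "chain_eval (coboundary X \<phi> (Suc n)) c = chain_eval (\<phi> n) (chain_boundary (Suc n) c)"
  using assms unfolding singular_chain_def
proof (induction rule: frag_induction)
  case (one \<sigma>)
  then show ?case
    by (simp add: coboundary_def chain_boundary_of chain_eval_sum chain_eval_sign
        del: sum.atMost_Suc)
qed (auto simp: chain_eval_diff chain_boundary_diff)

lemma coboundary_coboundary:
  fixes \<phi> :: "('a, 'r::{comm_ring,monoid_mult}) cochain"
  shows "coboundary X (coboundary X \<phi>) = (\<lambda>n \<sigma>. 0)"
proof (intro ext)
  fix n and \<sigma> :: "(nat \<Rightarrow> real) \<Rightarrow> 'a"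
  show "coboundary X (coboundary X \<phi>) n \<sigma> = 0"
  proof (cases "n \<ge> 2 \<and> singular_simplex n X \<sigma>")
    case True
    then obtain m where n: "n = Suc (Suc m)"
      using that [of "n - 2"] le_Suc_ex [of 2 n] by auto
    have c: "singular_chain (Suc (Suc m)) X (frag_of \<sigma>)"
      using True by (simp add: singular_chain_of n)
    have "coboundary X (coboundary X \<phi>) n \<sigma> =
        chain_eval (coboundary X (coboundary X \<phi>) (Suc (Suc m))) (frag_of \<sigma>)"
      by (simp add: n)
    also have "\<dots> = chain_eval (\<phi> m) (chain_boundary (Suc m) (chain_boundary (Suc (Suc m)) (frag_of \<sigma>)))"
      by (simp only: coboundary_chain_eval [OF c]
          coboundary_chain_eval [OF singular_chain_boundary_alt [OF c]])
    also have "\<dots> = 0"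
      using chain_boundary_boundary_alt [OF c] by simp
    finally show ?thesis .
  next
    case False
    \<comment> \<open>By truncated subtraction the second case covers both n = 0, where the outer
      coboundary is zero by definition, and n = 1, where the inner one is evaluated in degree
      0.\<close>
    then consider "\<not> singular_simplex n X \<sigma>" | "n - 1 = 0"
      by linarith
    then show ?thesis
      by cases (simp_all add: coboundary_def)
  qed
qed

section \<open>Additive closure of relative cochains, cocycles and coboundaries\<close>

lemma coboundary_add:
  "coboundary X (\<lambda>n \<sigma>. \<phi> n \<sigma> + \<psi> n \<sigma>) = (\<lambda>n \<sigma>. coboundary X \<phi> n \<sigma> + coboundary X \<psi> n \<sigma>)"
  by (auto simp: coboundary_def fun_eq_iff sum.distrib ring_distribs)

lemma coboundary_minus:
  "coboundary X (\<lambda>n \<sigma>. - \<phi> n \<sigma>) = (\<lambda>n \<sigma>. - coboundary X \<phi> n \<sigma>)"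
  by (auto simp: coboundary_def fun_eq_iff sum_negf)

lemma coboundary_zero [simp]: "coboundary X (\<lambda>n \<sigma>. 0) = (\<lambda>n \<sigma>. 0)"
  by (simp add: coboundary_def fun_eq_iff)

lemma rel_cochains_zero: "(\<lambda>n \<sigma>. 0) \<in> rel_cochains X A"
  by (simp add: rel_cochains_def)

lemma rel_cochains_add:
  assumes "\<phi> \<in> rel_cochains X A" "\<psi> \<in> rel_cochains X A"
  shows "(\<lambda>n \<sigma>. \<phi> n \<sigma> + \<psi> n \<sigma>) \<in> rel_cochains X A"
proof -
  have "{n. (\<lambda>\<sigma>. \<phi> n \<sigma> + \<psi> n \<sigma>) \<noteq> (\<lambda>\<sigma>. 0)} \<subseteq> {n. \<phi> n \<noteq> (\<lambda>\<sigma>. 0)} \<union> {n. \<psi> n \<noteq> (\<lambda>\<sigma>. 0)}"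
    by auto
  then show ?thesis
    using assms by (auto simp: rel_cochains_def intro: finite_subset)
qed

lemma rel_cochains_minus:
  "\<phi> \<in> rel_cochains X A \<Longrightarrow> (\<lambda>n \<sigma>. - \<phi> n \<sigma>) \<in> rel_cochains X A"
  by (simp add: rel_cochains_def fun_eq_iff)

lemma rel_cochains_coboundary:
  fixes \<phi> :: "('a, 'r::{comm_ring,monoid_mult}) cochain"
  assumes "\<phi> \<in> rel_cochains X A"
  shows "coboundary X \<phi> \<in> rel_cochains X A"
proof -
  have "coboundary X \<phi> n = (\<lambda>\<sigma>. 0)" if "n = 0 \<or> \<phi> (n - 1) = (\<lambda>\<sigma>. 0)" for n
    using that by (auto simp: coboundary_def fun_eq_iff)
  then have "{n. coboundary X \<phi> n \<noteq> (\<lambda>\<sigma>. 0)} \<subseteq> Suc ` {n. \<phi> n \<noteq> (\<lambda>\<sigma>. 0)}"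
    by (auto simp: image_iff) (metis Suc_pred' neq0_conv One_nat_def)
  moreover have "coboundary X \<phi> n \<sigma> = 0" if "singular_simplex n (subtopology X A) \<sigma>" for n \<sigma>
  proof (cases n)
    case (Suc m)
    have "\<phi> m (singular_face n k \<sigma>) = 0" if "k \<le> n" for k
      using assms singular_simplex_singular_face [OF \<open>singular_simplex n (subtopology X A) \<sigma>\<close>, of k] that
      by (auto simp: Suc rel_cochains_def)
    then show ?thesis
      by (simp add: coboundary_def Suc)
  qed (simp add: coboundary_def)
  moreover have "coboundary X \<phi> n \<sigma> = 0" if "\<not> singular_simplex n X \<sigma>" for n \<sigma>
    using that by (simp add: coboundary_def)
  moreover have "finite (Suc ` {n. \<phi> n \<noteq> (\<lambda>\<sigma>. 0)})"
    using assms by (simp add: rel_cochains_def)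
  ultimately show ?thesis
    unfolding rel_cochains_def by (blast intro: finite_subset)
qed

lemma rel_cocycles_iff:
  "\<phi> \<in> rel_cocycles X A \<longleftrightarrow> \<phi> \<in> rel_cochains X A \<and> coboundary X \<phi> = (\<lambda>n \<sigma>. 0)"
  by (simp add: rel_cocycles_def)

lemma rel_cocycles_add:
  "\<phi> \<in> rel_cocycles X A \<Longrightarrow> \<psi> \<in> rel_cocycles X A \<Longrightarrow> (\<lambda>n \<sigma>. \<phi> n \<sigma> + \<psi> n \<sigma>) \<in> rel_cocycles X A"
  by (simp add: rel_cocycles_iff rel_cochains_add coboundary_add)

lemma rel_coboundaries_subset: "rel_coboundaries X A \<subseteq> rel_cocycles X A"
  by (auto simp: rel_coboundaries_def rel_cocycles_iff rel_cochains_coboundary coboundary_coboundary)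

lemma rel_coboundaries_zero: "(\<lambda>n \<sigma>. 0) \<in> rel_coboundaries X A"
  unfolding rel_coboundaries_def
  by (rule image_eqI [where x = "\<lambda>n \<sigma>. 0"]) (simp_all add: rel_cochains_zero)

lemma rel_coboundaries_add:
  "\<phi> \<in> rel_coboundaries X A \<Longrightarrow> \<psi> \<in> rel_coboundaries X A \<Longrightarrow>
    (\<lambda>n \<sigma>. \<phi> n \<sigma> + \<psi> n \<sigma>) \<in> rel_coboundaries X A"
  by (auto simp: rel_coboundaries_def intro!: rel_cochains_add simp flip: coboundary_add)

lemma rel_coboundaries_minus:
  "\<phi> \<in> rel_coboundaries X A \<Longrightarrow> (\<lambda>n \<sigma>. - \<phi> n \<sigma>) \<in> rel_coboundaries X A"
  by (auto simp: rel_coboundaries_def intro!: rel_cochains_minus simp flip: coboundary_minus)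

section \<open>The Leibniz rule for the cup product\<close>

lemma shift_in_standard_simplex:
  assumes "x \<in> standard_simplex j"
  shows "(\<lambda>k. if k < i then 0 else x (k - i)) \<in> standard_simplex (i + j)"
proof -
  have "(\<Sum>k\<le>i + j. if k < i then 0 else x (k - i)) = (\<Sum>k\<in>{i..i + j}. x (k - i))"
    by (rule sum.mono_neutral_cong_right) auto
  also have "\<dots> = (\<Sum>k\<le>j. x k)"
    by (rule sum.reindex_bij_witness [of _ "\<lambda>k. k + i" "\<lambda>k. k - i"]) auto
  finally show ?thesis
    using assms by (auto simp: standard_simplex_def)
qed

lemma continuous_map_standard_simplex:
  assumes "\<And>k. continuous_map (powertop_real UNIV) euclideanreal (\<lambda>x. g x k)"
    and "\<And>x. x \<in> standard_simplex p \<Longrightarrow> g x \<in> standard_simplex q"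
  shows "continuous_map (subtopology (powertop_real UNIV) (standard_simplex p))
           (subtopology (powertop_real UNIV) (standard_simplex q)) g"
  using assms
  by (auto simp: continuous_map_in_subtopology continuous_map_componentwise
      intro: continuous_map_from_subtopology)

lemma singular_simplex_reparametrize:
  assumes "singular_simplex q X \<sigma>"
    and "continuous_map (subtopology (powertop_real UNIV) (standard_simplex p))
           (subtopology (powertop_real UNIV) (standard_simplex q)) g"
  shows "singular_simplex p X (restrict (\<lambda>x. \<sigma> (g x)) (standard_simplex p))"
  using continuous_map_compose [OF assms(2), of X \<sigma>] assms(1)
  by (simp add: singular_simplex_def o_def)

lemma singular_simplex_front_face:
  assumes "singular_simplex n X \<sigma>" "i \<le> n"
  shows "singular_simplex i X (front_face i \<sigma>)"
proof -
  have "continuous_map (subtopology (powertop_real UNIV) (standard_simplex i))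
           (subtopology (powertop_real UNIV) (standard_simplex n)) (\<lambda>x. x)"
    by (rule continuous_map_standard_simplex)
      (use standard_simplex_mono [OF assms(2)] in \<open>auto intro: continuous_map_product_projection\<close>)
  from singular_simplex_reparametrize [OF assms(1) this] show ?thesis
    by (simp add: front_face_def)
qed

lemma singular_simplex_back_face:
  assumes "singular_simplex (i + j) X \<sigma>"
  shows "singular_simplex j X (back_face i j \<sigma>)"
proof -
  have "continuous_map (subtopology (powertop_real UNIV) (standard_simplex j))
           (subtopology (powertop_real UNIV) (standard_simplex (i + j)))
           (\<lambda>x k. if k < i then 0 else x (k - i))"
    by (rule continuous_map_standard_simplex)
      (auto intro: continuous_map_product_projection shift_in_standard_simplex)
  from singular_simplex_reparametrize [OF assms(1) this] show ?thesis
    by (simp add: back_face_def)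
qed

section \<open>Front and back faces of the faces of a simplex\<close>

lemma simplical_face_last:
  "x \<in> standard_simplex i \<Longrightarrow> i < k \<Longrightarrow> simplical_face k x = x"
  by (auto simp: simplical_face_def standard_simplex_def fun_eq_iff)

text \<open>A normal form: this lemma and the next bring both orders of taking faces to \<sigma>
  after the k-th face map, restricted to the same simplex, so that they can be compared
  directly.\<close>

lemma singular_face_front_face:
  "k \<le> Suc i \<Longrightarrow> singular_face (Suc i) k (front_face (Suc i) \<sigma>) =
     restrict (\<lambda>x. \<sigma> (simplical_face k x)) (standard_simplex i)"
  using simplical_face_in_standard_simplex [of "Suc i" k]
  by (auto simp: singular_face_def front_face_def fun_eq_iff)

lemma front_face_singular_face:
  assumes "i \<le> n"
  shows "front_face i (singular_face (Suc n) k \<sigma>) =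
     restrict (\<lambda>x. \<sigma> (simplical_face k x)) (standard_simplex i)"
  using standard_simplex_mono [OF assms]
  by (auto simp: singular_face_def front_face_def fun_eq_iff)

lemma front_face_singular_face_low:
  "k \<le> i \<Longrightarrow> i \<le> n \<Longrightarrow>
    front_face i (singular_face (Suc n) k \<sigma>) = singular_face (Suc i) k (front_face (Suc i) \<sigma>)"
  by (simp add: front_face_singular_face singular_face_front_face)

text \<open>A point of the standard i-simplex has only zeros after coordinate i, so inserting a zero
  at a position k > i does not change it.\<close>

lemma front_face_singular_face_high:
  "i < k \<Longrightarrow> i \<le> n \<Longrightarrow> front_face i (singular_face (Suc n) k \<sigma>) = front_face i \<sigma>"
  by (simp add: front_face_singular_face)
    (simp add: front_face_def simplical_face_last cong: restrict_cong)

lemma singular_face_front_face_last: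
  "singular_face (Suc i) (Suc i) (front_face (Suc i) \<sigma>) = front_face i \<sigma>"
  by (simp add: singular_face_front_face)
    (simp add: front_face_def simplical_face_last cong: restrict_cong)

lemma back_face_singular_face:
  "back_face i j (singular_face (Suc (i + j)) k \<sigma>) =
     restrict (\<lambda>x. \<sigma> (simplical_face k (\<lambda>m. if m < i then 0 else x (m - i)))) (standard_simplex j)"
  using shift_in_standard_simplex
  by (auto simp: singular_face_def back_face_def fun_eq_iff)

text \<open>Deleting a vertex k \<le> i renumbers the later ones down by one: the vertices i, ..., i
  + j of the face are the vertices i + 1, ..., i + j + 1 of \<sigma>.\<close>

lemma back_face_singular_face_low:
  assumes "k \<le> i"
  shows "back_face i j (singular_face (Suc (i + j)) k \<sigma>) = back_face (Suc i) j \<sigma>"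
proof -
  have "simplical_face k (\<lambda>m. if m < i then 0 else x (m - i)) =
      (\<lambda>m. if m < Suc i then 0 else x (m - Suc i))" for x :: "nat \<Rightarrow> real"
    using assms by (auto simp: simplical_face_def fun_eq_iff)
  then show ?thesis
    by (simp only: back_face_singular_face) (simp add: back_face_def)
qed

lemma back_face_singular_face_high:
  assumes "k \<le> Suc j"
  shows "back_face i j (singular_face (Suc (i + j)) (i + k) \<sigma>) =
      singular_face (Suc j) k (back_face i (Suc j) \<sigma>)"
proof -
  have "simplical_face (i + k) (\<lambda>m. if m < i then 0 else x (m - i)) =
      (\<lambda>m. if m < i then 0 else simplical_face k x (m - i))" for x :: "nat \<Rightarrow> real"
    by (auto simp: simplical_face_def fun_eq_iff diff_commute)
  moreover have "simplical_face k x \<in> standard_simplex (Suc j)" if "x \<in> standard_simplex j" for x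
    using simplical_face_in_standard_simplex [of "Suc j" k x] assms that by simp
  ultimately show ?thesis
    by (simp only: back_face_singular_face) (simp add: singular_face_def back_face_def cong: restrict_cong)
qed

text \<open>Deleting vertex i falls under both preceding lemmas, as k = 0 of the one and k = i of
  the other; comparing their right-hand sides gives the claim.\<close>

lemma singular_face_back_face_first:
  "singular_face (Suc j) 0 (back_face i (Suc j) \<sigma>) = back_face (Suc i) j \<sigma>"
  using back_face_singular_face_high [of 0 j i \<sigma>] back_face_singular_face_low [of i i j \<sigma>] by simp

text \<open>The sign (-1)^deg(\<phi>) of the Leibniz rule, made an operator because \<phi> need not
  be homogeneous.\<close>

definition grading_sign :: "('a, 'r::{comm_ring,monoid_mult}) cochain \<Rightarrow> ('a, 'r) cochain" where
  "grading_sign \<phi> = (\<lambda>n \<sigma>. (- 1) ^ n * \<phi> n \<sigma>)"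

lemma minus_one_power_square:
  "(- 1) ^ n * ((- 1) ^ n * (a::'r::{comm_ring,monoid_mult})) = a"
  by (induction n) (simp_all add: mult.assoc)

lemma grading_sign_grading_sign [simp]: "grading_sign (grading_sign \<phi>) = \<phi>"
  by (simp add: grading_sign_def minus_one_power_square)

lemma grading_sign_rel_cochains:
  assumes "\<phi> \<in> rel_cochains X A"
  shows "grading_sign \<phi> \<in> rel_cochains X A"
proof -
  have "{n. grading_sign \<phi> n \<noteq> (\<lambda>\<sigma>. 0)} \<subseteq> {n. \<phi> n \<noteq> (\<lambda>\<sigma>. 0)}"
    by (auto simp: grading_sign_def)
  with assms show ?thesis
    by (auto simp: rel_cochains_def grading_sign_def intro: finite_subset)
qed

text \<open>The coboundary in degree n reads \<phi> in degree n - 1, whence the extra minus sign. In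
  particular the operator preserves cocycles.\<close>

lemma coboundary_grading_sign:
  "coboundary X (grading_sign \<phi>) n \<sigma> = - ((- 1) ^ n * coboundary X \<phi> n \<sigma>)"
proof (cases n)
  case (Suc m)
  show ?thesis
    by (simp add: coboundary_def grading_sign_def Suc sum_distrib_left sum_negf mult.left_commute
        del: sum.atMost_Suc)
qed (simp add: coboundary_def)

lemma grading_sign_rel_cocycles:
  "\<phi> \<in> rel_cocycles X A \<Longrightarrow> grading_sign \<phi> \<in> rel_cocycles X A"
  by (simp add: rel_cocycles_iff grading_sign_rel_cochains coboundary_grading_sign fun_eq_iff)

lemma coboundary_0: "coboundary X \<phi> 0 \<sigma> = 0"
  by (simp add: coboundary_def)

lemma coboundary_cup:
  fixes \<phi> \<psi> :: "('a, 'r::{comm_ring,monoid_mult}) cochain"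
  shows "coboundary X (cup X \<phi> \<psi>) =
    (\<lambda>n \<sigma>. cup X (coboundary X \<phi>) \<psi> n \<sigma> + cup X (grading_sign \<phi>) (coboundary X \<psi>) n \<sigma>)"
proof (intro ext)
  fix n and \<sigma> :: "(nat \<Rightarrow> real) \<Rightarrow> 'a"
  show "coboundary X (cup X \<phi> \<psi>) n \<sigma> =
    cup X (coboundary X \<phi>) \<psi> n \<sigma> + cup X (grading_sign \<phi>) (coboundary X \<psi>) n \<sigma>"
  proof (cases "singular_simplex n X \<sigma>")
    case ss: True
    show ?thesis
    proof (cases n)
      case 0
      then show ?thesis
        by (simp add: coboundary_def cup_def)
    next
      case (Suc m)
      define F where "F k i = \<phi> i (front_face i (singular_face n k \<sigma>)) *
          \<psi> (m - i) (back_face i (m - i) (singular_face n k \<sigma>))" for k i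
      \<comment> \<open>\<open>G i\<close> splits the vertices into 0, ..., i and i + 1, ..., n
        without overlap. It arises from the last face of a front face and from the first face of a
        back face, with opposite signs, and cancels in the sum of the two products.\<close>
      define G where "G i = \<phi> i (front_face i \<sigma>) * \<psi> (m - i) (back_face (Suc i) (m - i) \<sigma>)" for i
      have 1: "coboundary X \<phi> (Suc i) (front_face (Suc i) \<sigma>) *
          \<psi> (m - i) (back_face (Suc i) (m - i) \<sigma>) =
          (\<Sum>k\<le>i. (- 1) ^ k * F k i) - (- 1) ^ i * G i" if i: "i \<le> m" for i
      proof -
        have "F k i = \<phi> i (singular_face (Suc i) k (front_face (Suc i) \<sigma>)) *
            \<psi> (m - i) (back_face (Suc i) (m - i) \<sigma>)" if "k \<le> i" for k
          using i that back_face_singular_face_low [of k i "m - i" \<sigma>]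
          by (simp add: F_def Suc front_face_singular_face_low)
        moreover have "singular_simplex (Suc i) X (front_face (Suc i) \<sigma>)"
          using i ss by (auto intro: singular_simplex_front_face simp: Suc)
        ultimately show ?thesis
          by (simp add: coboundary_def G_def singular_face_front_face_last sum_distrib_right
              ring_distribs mult.assoc)
      qed
      have 2: "grading_sign \<phi> i (front_face i \<sigma>) *
          coboundary X \<psi> (Suc (m - i)) (back_face i (Suc (m - i)) \<sigma>) =
          (- 1) ^ i * G i + (\<Sum>k\<in>{Suc i..n}. (- 1) ^ k * F k i)" if i: "i \<le> m" for i
      proof -
        have F: "F (Suc (i + k)) i = \<phi> i (front_face i \<sigma>) *
            \<psi> (m - i) (singular_face (Suc (m - i)) (Suc k) (back_face i (Suc (m - i)) \<sigma>))"
          if "k \<le> m - i" for k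
          using i that back_face_singular_face_high [of "Suc k" "m - i" i \<sigma>]
          by (simp add: F_def Suc front_face_singular_face_high)
        have "(\<Sum>k\<in>{Suc i..n}. (- 1) ^ k * F k i) =
            (\<Sum>k\<le>m - i. (- 1) ^ Suc (i + k) * F (Suc (i + k)) i)"
          by (rule sum.reindex_bij_witness [of _ "\<lambda>k. Suc (i + k)" "\<lambda>k. k - Suc i"])
            (use i in \<open>auto simp: Suc\<close>)
        also have "\<dots> = (\<Sum>k\<le>m - i. (- 1) ^ i * (\<phi> i (front_face i \<sigma>) * ((- 1) ^ Suc k *
            \<psi> (m - i) (singular_face (Suc (m - i)) (Suc k) (back_face i (Suc (m - i)) \<sigma>)))))"
          by (intro sum.cong) (auto simp: F power_add mult_ac)
        moreover have "singular_simplex (Suc (m - i)) X (back_face i (Suc (m - i)) \<sigma>)"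
          using i ss by (auto intro: singular_simplex_back_face simp: Suc)
        ultimately show ?thesis
          by (simp add: coboundary_def G_def grading_sign_def sum.atMost_Suc_shift
              singular_face_back_face_first sum_distrib_left ring_distribs mult.assoc
              del: sum.atMost_Suc)
      qed
      have 3: "(\<Sum>k\<le>n. (- 1) ^ k * F k i) =
          (\<Sum>k\<le>i. (- 1) ^ k * F k i) + (\<Sum>k\<in>{Suc i..n}. (- 1) ^ k * F k i)" if "i \<le> m" for i
      proof -
        have "{..n} = {..i} \<union> {Suc i..n}"
          using that Suc by auto
        then show ?thesis
          by (simp add: sum.union_disjoint)
      qed
      have "coboundary X (cup X \<phi> \<psi>) n \<sigma> = (\<Sum>k\<le>n. (- 1) ^ k * (\<Sum>i\<le>m. F k i))"
        using ss singular_simplex_singular_face [OF ss]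
        by (auto simp: coboundary_def cup_def Suc F_def simp del: sum.atMost_Suc intro!: sum.cong)
      also have "\<dots> = (\<Sum>i\<le>m. \<Sum>k\<le>n. (- 1) ^ k * F k i)"
        by (subst sum.swap) (simp add: sum_distrib_left)
      also have "\<dots> = (\<Sum>i\<le>m. coboundary X \<phi> (Suc i) (front_face (Suc i) \<sigma>) *
            \<psi> (m - i) (back_face (Suc i) (m - i) \<sigma>)) +
          (\<Sum>i\<le>m. grading_sign \<phi> i (front_face i \<sigma>) *
            coboundary X \<psi> (Suc (m - i)) (back_face i (Suc (m - i)) \<sigma>))"
        unfolding sum.distrib [symmetric]
        by (intro sum.cong refl) (simp only: 1 2 3 atMost_iff, simp)
      \<comment> \<open>The cup product has one summand more, i = 0 here and i = n for the second
        product below. It contains a coboundary in degree 0, which is zero.\<close>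
      also have "(\<Sum>i\<le>m. coboundary X \<phi> (Suc i) (front_face (Suc i) \<sigma>) *
            \<psi> (m - i) (back_face (Suc i) (m - i) \<sigma>)) = cup X (coboundary X \<phi>) \<psi> n \<sigma>"
        using ss by (simp add: cup_def Suc sum.atMost_Suc_shift coboundary_0 del: sum.atMost_Suc)
      also have "(\<Sum>i\<le>m. grading_sign \<phi> i (front_face i \<sigma>) *
            coboundary X \<psi> (Suc (m - i)) (back_face i (Suc (m - i)) \<sigma>)) =
          cup X (grading_sign \<phi>) (coboundary X \<psi>) n \<sigma>"
        using ss by (auto simp: cup_def Suc coboundary_0 Suc_diff_le intro!: sum.cong)
      finally show ?thesis .
    qed
  qed (simp add: coboundary_def cup_def)
qed

section \<open>Cohomology classes and their products\<close>

lemma cup_add_left: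
  "cup X (\<lambda>n \<sigma>. \<phi> n \<sigma> + \<phi>' n \<sigma>) \<psi> = (\<lambda>n \<sigma>. cup X \<phi> \<psi> n \<sigma> + cup X \<phi>' \<psi> n \<sigma>)"
  by (simp add: cup_def fun_eq_iff sum.distrib ring_distribs)

lemma cup_add_right:
  "cup X \<phi> (\<lambda>n \<sigma>. \<psi> n \<sigma> + \<psi>' n \<sigma>) = (\<lambda>n \<sigma>. cup X \<phi> \<psi> n \<sigma> + cup X \<phi> \<psi>' n \<sigma>)"
  by (simp add: cup_def fun_eq_iff sum.distrib ring_distribs)

lemma cup_zero_left [simp]: "cup X (\<lambda>n \<sigma>. 0) \<psi> = (\<lambda>n \<sigma>. 0)"
  and cup_zero_right [simp]: "cup X \<phi> (\<lambda>n \<sigma>. 0) = (\<lambda>n \<sigma>. 0)"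
  by (simp_all add: cup_def fun_eq_iff)

definition vanishes_on ::
  "'a topology \<Rightarrow> 'a set \<Rightarrow> ('a, 'r::{comm_ring,monoid_mult}) cochain \<Rightarrow> bool" where
  "vanishes_on X U \<phi> \<longleftrightarrow> (\<forall>n \<sigma>. singular_simplex n (subtopology X U) \<sigma> \<longrightarrow> \<phi> n \<sigma> = 0)"

text \<open>Front faces of a simplex in U stay in U, as do back faces in the next lemma. Hence a
  product of several cochains vanishes on every set on which at least one factor does.\<close>

lemma vanishes_on_cup_left: "vanishes_on X U \<phi> \<Longrightarrow> vanishes_on X U (cup X \<phi> \<psi>)"
  by (auto simp: vanishes_on_def cup_def singular_simplex_front_face intro!: sum.neutral)

lemma vanishes_on_cup_right:
  assumes "vanishes_on X U \<psi>"
  shows "vanishes_on X U (cup X \<phi> \<psi>)"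
proof -
  have "\<psi> (n - i) (back_face i (n - i) \<sigma>) = 0"
    if "singular_simplex n (subtopology X U) \<sigma>" "i \<le> n" for n i \<sigma>
    using assms singular_simplex_back_face [of i "n - i" "subtopology X U" \<sigma>] that
    by (simp add: vanishes_on_def)
  then show ?thesis
    by (auto simp: vanishes_on_def cup_def intro!: sum.neutral)
qed

lemma rel_cochains_cup:
  fixes \<phi> \<psi> :: "('a, 'r::{comm_ring,monoid_mult}) cochain"
  assumes \<phi>: "\<phi> \<in> rel_cochains X A" and \<psi>: "\<psi> \<in> rel_cochains X A"
  shows "cup X \<phi> \<psi> \<in> rel_cochains X A"
proof -
  let ?S = "{n. \<phi> n \<noteq> (\<lambda>\<sigma>. 0)}" and ?T = "{n. \<psi> n \<noteq> (\<lambda>\<sigma>. 0)}"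
  have "n \<in> (\<lambda>(i, j). i + j) ` (?S \<times> ?T)" if n: "cup X \<phi> \<psi> n \<noteq> (\<lambda>\<sigma>. 0)" for n
  proof -
    obtain \<sigma> where "cup X \<phi> \<psi> n \<sigma> \<noteq> 0"
      using n by (auto simp: fun_eq_iff)
    then have "(\<Sum>i\<le>n. \<phi> i (front_face i \<sigma>) * \<psi> (n - i) (back_face i (n - i) \<sigma>)) \<noteq> 0"
      by (simp add: cup_def split: if_splits)
    then obtain i where "i \<le> n" "\<phi> i (front_face i \<sigma>) * \<psi> (n - i) (back_face i (n - i) \<sigma>) \<noteq> 0"
      by (meson atMost_iff sum.neutral)
    then show ?thesis
      by (intro image_eqI [where x = "(i, n - i)"]) auto
  qed
  then have "{n. cup X \<phi> \<psi> n \<noteq> (\<lambda>\<sigma>. 0)} \<subseteq> (\<lambda>(i, j). i + j) ` (?S \<times> ?T)"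
    by blast
  moreover have "finite ((\<lambda>(i, j). i + j) ` (?S \<times> ?T))"
    using \<phi> \<psi> by (simp add: rel_cochains_def)
  moreover have "vanishes_on X A (cup X \<phi> \<psi>)"
    using \<phi> by (intro vanishes_on_cup_left) (simp add: rel_cochains_def vanishes_on_def)
  ultimately show ?thesis
    by (auto simp: rel_cochains_def vanishes_on_def cup_def intro: finite_subset)
qed

lemma rel_cocycles_cup:
  "\<phi> \<in> rel_cocycles X A \<Longrightarrow> \<psi> \<in> rel_cocycles X A \<Longrightarrow> cup X \<phi> \<psi> \<in> rel_cocycles X A"
  by (simp add: rel_cocycles_iff rel_cochains_cup coboundary_cup)

lemma rel_coboundaries_cup_left:
  assumes "\<phi> \<in> rel_coboundaries X A" "\<psi> \<in> rel_cocycles X A"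
  shows "cup X \<phi> \<psi> \<in> rel_coboundaries X A"
proof -
  obtain \<alpha> where \<alpha>: "\<alpha> \<in> rel_cochains X A" "\<phi> = coboundary X \<alpha>"
    using assms by (auto simp: rel_coboundaries_def)
  have "cup X \<phi> \<psi> = coboundary X (cup X \<alpha> \<psi>)"
    using assms(2) by (simp add: \<alpha> coboundary_cup rel_cocycles_iff)
  then show ?thesis
    using \<alpha> assms(2) by (simp add: rel_coboundaries_def rel_cocycles_iff rel_cochains_cup)
qed

text \<open>The Leibniz rule is applied to \<open>grading_sign \<phi>\<close>: one term vanishes
  because this is again a cocycle, and in the other the operator is applied twice, which leaves
  \<phi>.\<close>

lemma rel_coboundaries_cup_right:
  assumes "\<phi> \<in> rel_cocycles X A" "\<psi> \<in> rel_coboundaries X A"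
  shows "cup X \<phi> \<psi> \<in> rel_coboundaries X A"
proof -
  obtain \<beta> where \<beta>: "\<beta> \<in> rel_cochains X A" "\<psi> = coboundary X \<beta>"
    using assms by (auto simp: rel_coboundaries_def)
  have \<phi>: "grading_sign \<phi> \<in> rel_cocycles X A"
    using assms by (simp add: grading_sign_rel_cocycles)
  then have "cup X \<phi> \<psi> = coboundary X (cup X (grading_sign \<phi>) \<beta>)"
    by (simp add: \<beta> coboundary_cup rel_cocycles_iff)
  then show ?thesis
    using \<beta> \<phi> by (simp add: rel_coboundaries_def rel_cocycles_iff rel_cochains_cup)
qed

definition cohomology_class ::
  "'a topology \<Rightarrow> 'a set \<Rightarrow> ('a, 'r::{comm_ring,monoid_mult}) cochain \<Rightarrow> ('a, 'r) cochain set" where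
  "cohomology_class X A \<phi> = rel_coboundaries X A +>\<^bsub>cocycle_ring X A\<^esub> \<phi>"

lemma cohomology_class_def':
  "cohomology_class X A \<phi> = {\<lambda>n \<sigma>. \<beta> n \<sigma> + \<phi> n \<sigma> | \<beta>. \<beta> \<in> rel_coboundaries X A}"
  by (auto simp: cohomology_class_def a_r_coset_def' cocycle_ring_def)

lemma mem_cohomology_class:
  "\<psi> \<in> cohomology_class X A \<phi> \<longleftrightarrow> (\<lambda>n \<sigma>. \<psi> n \<sigma> - \<phi> n \<sigma>) \<in> rel_coboundaries X A"
proof
  assume *: "(\<lambda>n \<sigma>. \<psi> n \<sigma> - \<phi> n \<sigma>) \<in> rel_coboundaries X A"
  have "\<psi> = (\<lambda>n \<sigma>. (\<psi> n \<sigma> - \<phi> n \<sigma>) + \<phi> n \<sigma>)"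
    by simp
  then show "\<psi> \<in> cohomology_class X A \<phi>"
    unfolding cohomology_class_def' by (intro CollectI exI [of _ "\<lambda>n \<sigma>. \<psi> n \<sigma> - \<phi> n \<sigma>"] conjI *)
qed (auto simp: cohomology_class_def')

lemma rel_coboundaries_diff:
  "\<phi> \<in> rel_coboundaries X A \<Longrightarrow> \<psi> \<in> rel_coboundaries X A \<Longrightarrow>
    (\<lambda>n \<sigma>. \<phi> n \<sigma> - \<psi> n \<sigma>) \<in> rel_coboundaries X A"
  using rel_coboundaries_add [OF _ rel_coboundaries_minus, of \<phi> X A \<psi>] by simp

lemma cohomology_class_self: "\<phi> \<in> cohomology_class X A \<phi>"
  by (simp add: mem_cohomology_class rel_coboundaries_zero)

lemma cohomology_class_eqI:
  assumes "(\<lambda>n \<sigma>. \<psi> n \<sigma> - \<phi> n \<sigma>) \<in> rel_coboundaries X A"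
  shows "cohomology_class X A \<psi> = cohomology_class X A \<phi>"
proof -
  have "\<theta> \<in> cohomology_class X A \<psi> \<longleftrightarrow> \<theta> \<in> cohomology_class X A \<phi>" for \<theta>
    using rel_coboundaries_add [of "\<lambda>n \<sigma>. \<theta> n \<sigma> - \<psi> n \<sigma>" X A "\<lambda>n \<sigma>. \<psi> n \<sigma> - \<phi> n \<sigma>"]
      rel_coboundaries_diff [of "\<lambda>n \<sigma>. \<theta> n \<sigma> - \<phi> n \<sigma>" X A "\<lambda>n \<sigma>. \<psi> n \<sigma> - \<phi> n \<sigma>"] assms
    by (auto simp: mem_cohomology_class)
  then show ?thesis
    by blast
qed

lemma cohomology_class_eq: "\<psi> \<in> cohomology_class X A \<phi> \<Longrightarrow> cohomology_class X A \<psi> = cohomology_class X A \<phi>"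
  by (simp add: cohomology_class_eqI mem_cohomology_class)

lemma cohomology_class_coboundary:
  "\<phi> \<in> rel_coboundaries X A \<Longrightarrow> cohomology_class X A \<phi> = rel_coboundaries X A"
  using cohomology_class_eqI [of \<phi> "\<lambda>n \<sigma>. 0" X A]
  by (simp add: mem_cohomology_class set_eq_iff)

lemma cohomology_class_subset:
  "\<phi> \<in> rel_cocycles X A \<Longrightarrow> cohomology_class X A \<phi> \<subseteq> rel_cocycles X A"
  using rel_coboundaries_subset by (auto simp: cohomology_class_def' intro!: rel_cocycles_add)

lemma cohomology_ring_simps:
  "carrier (cohomology_ring X A) = cohomology_class X A ` rel_cocycles X A"
  "u \<otimes>\<^bsub>cohomology_ring X A\<^esub> v = (\<Union>\<phi>\<in>u. \<Union>\<psi>\<in>v. cohomology_class X A (cup X \<phi> \<psi>))"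
  "u \<oplus>\<^bsub>cohomology_ring X A\<^esub> v = (\<Union>\<phi>\<in>u. \<Union>\<psi>\<in>v. {\<lambda>n \<sigma>. \<phi> n \<sigma> + \<psi> n \<sigma>})"
  "\<zero>\<^bsub>cohomology_ring X A\<^esub> = rel_coboundaries X A"
  by (auto simp: cohomology_ring_def FactRing_def A_RCOSETS_def' rcoset_mult_def set_add_def'
      cohomology_class_def) (auto simp: cocycle_ring_def)

lemma cohomology_class_mult:
  assumes \<phi>: "\<phi> \<in> rel_cocycles X A" and \<psi>: "\<psi> \<in> rel_cocycles X A"
  shows "cohomology_class X A \<phi> \<otimes>\<^bsub>cohomology_ring X A\<^esub> cohomology_class X A \<psi> =
    cohomology_class X A (cup X \<phi> \<psi>)"
proof -
  have "cohomology_class X A (cup X \<phi>' \<psi>') = cohomology_class X A (cup X \<phi> \<psi>)"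
    if \<phi>': "\<phi>' \<in> cohomology_class X A \<phi>" and \<psi>': "\<psi>' \<in> cohomology_class X A \<psi>" for \<phi>' \<psi>'
  proof -
    obtain \<alpha> where \<alpha>: "\<alpha> \<in> rel_coboundaries X A" "\<phi>' = (\<lambda>n \<sigma>. \<alpha> n \<sigma> + \<phi> n \<sigma>)"
      using \<phi>' by (auto simp: cohomology_class_def')
    obtain \<beta> where \<beta>: "\<beta> \<in> rel_coboundaries X A" "\<psi>' = (\<lambda>n \<sigma>. \<beta> n \<sigma> + \<psi> n \<sigma>)"
      using \<psi>' by (auto simp: cohomology_class_def')
    have "\<psi>' \<in> rel_cocycles X A"
      using \<psi>' cohomology_class_subset [OF \<psi>] by blast
    \<comment> \<open>The difference of the two products is split asymmetrically, with \<psi>' in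
      one summand and \<phi> in the other, so that each summand is a coboundary times a
      cocycle.\<close>
    then have "(\<lambda>n \<sigma>. cup X \<alpha> \<psi>' n \<sigma> + cup X \<phi> \<beta> n \<sigma>) \<in> rel_coboundaries X A"
      using \<alpha> \<beta> \<phi> by (intro rel_coboundaries_add rel_coboundaries_cup_left rel_coboundaries_cup_right)
    moreover have "cup X \<phi>' \<psi>' n \<sigma> - cup X \<phi> \<psi> n \<sigma> = cup X \<alpha> \<psi>' n \<sigma> + cup X \<phi> \<beta> n \<sigma>" for n \<sigma>
      by (simp add: \<alpha>(2) \<beta>(2) cup_add_left cup_add_right)
    ultimately show ?thesis
      by (intro cohomology_class_eqI) simp
  qed
  then have "(\<Union>\<phi>'\<in>cohomology_class X A \<phi>. \<Union>\<psi>'\<in>cohomology_class X A \<psi>.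
        cohomology_class X A (cup X \<phi>' \<psi>')) =
      (\<Union>\<phi>'\<in>cohomology_class X A \<phi>. \<Union>\<psi>'\<in>cohomology_class X A \<psi>.
        cohomology_class X A (cup X \<phi> \<psi>))"
    by (intro SUP_cong refl)
  also have "\<dots> = cohomology_class X A (cup X \<phi> \<psi>)"
    using cohomology_class_self [of \<phi> X A] cohomology_class_self [of \<psi> X A] by blast
  finally show ?thesis
    by (simp only: cohomology_ring_simps)
qed

lemma cohomology_class_foldl_mult:
  assumes "\<phi> \<in> rel_cocycles X A" "set \<psi>s \<subseteq> rel_cocycles X A"
  shows "foldl (\<otimes>\<^bsub>cohomology_ring X A\<^esub>) (cohomology_class X A \<phi>) (map (cohomology_class X A) \<psi>s) =
    cohomology_class X A (foldl (cup X) \<phi> \<psi>s)"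
  using assms
  by (induction \<psi>s arbitrary: \<phi>) (simp_all add: cohomology_class_mult rel_cocycles_cup)

lemma rel_cocycles_foldl_cup:
  "\<phi> \<in> rel_cocycles X A \<Longrightarrow> set \<psi>s \<subseteq> rel_cocycles X A \<Longrightarrow> foldl (cup X) \<phi> \<psi>s \<in> rel_cocycles X A"
  by (induction \<psi>s arbitrary: \<phi>) (simp_all add: rel_cocycles_cup)

lemma vanishes_on_foldl_cup:
  "\<exists>\<theta>\<in>set (\<phi> # \<psi>s). vanishes_on X U \<theta> \<Longrightarrow> vanishes_on X U (foldl (cup X) \<phi> \<psi>s)"
proof (induction \<psi>s arbitrary: \<phi>)
  case (Cons \<psi> \<psi>s)
  then have "\<exists>\<theta>\<in>set (cup X \<phi> \<psi> # \<psi>s). vanishes_on X U \<theta>"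
    by (auto intro: vanishes_on_cup_left vanishes_on_cup_right)
  then show ?case
    using Cons.IH by simp
qed simp

section \<open>Homomorphisms induced by maps of pairs\<close>

lemma singular_simplex_in_set:
  "singular_simplex n (subtopology X A) \<sigma> \<Longrightarrow> continuous_map X Y f \<Longrightarrow> f ` (topspace X \<inter> A) \<subseteq> D \<Longrightarrow>
    singular_simplex n (subtopology Y D) (simplex_map n f \<sigma>)"
  by (rule singular_simplex_simplex_map [where X = "subtopology X A"])
    (auto simp: continuous_map_in_subtopology continuous_map_from_subtopology)

lemma cochain_map_rel_cochains:
  assumes "map_of_pairs B C X A f" "\<phi> \<in> rel_cochains X A"
  shows "cochain_map B f \<phi> \<in> rel_cochains B C"
proof -
  have "{n. cochain_map B f \<phi> n \<noteq> (\<lambda>\<sigma>. 0)} \<subseteq> {n. \<phi> n \<noteq> (\<lambda>\<sigma>. 0)}"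
    by (auto simp: cochain_map_def fun_eq_iff)
  moreover have "singular_simplex n (subtopology X A) (simplex_map n f \<sigma>)"
    if "singular_simplex n (subtopology B C) \<sigma>" for n \<sigma>
    using that assms(1) by (intro singular_simplex_in_set [of n B C]) (auto simp: map_of_pairs_def)
  ultimately show ?thesis
    using assms(2) by (auto simp: rel_cochains_def cochain_map_def intro: finite_subset)
qed

lemma coboundary_cochain_map:
  assumes "continuous_map B X f"
  shows "coboundary B (cochain_map B f \<phi>) = cochain_map B f (coboundary X \<phi>)"
proof (intro ext)
  fix n \<sigma>
  show "coboundary B (cochain_map B f \<phi>) n \<sigma> = cochain_map B f (coboundary X \<phi>) n \<sigma>"
  proof (cases "n > 0 \<and> singular_simplex n B \<sigma>")
    case True
    have "singular_face n k (simplex_map n f \<sigma>) = simplex_map (n - 1) f (singular_face n k \<sigma>)"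
      if "k \<le> n" for k
      using True that simplical_face_in_standard_simplex [of n k]
      by (auto simp: singular_face_def simplex_map_def fun_eq_iff)
    then show ?thesis
      using True assms singular_simplex_singular_face [of n B \<sigma>]
      by (auto simp: coboundary_def cochain_map_def singular_simplex_simplex_map intro!: sum.cong)
  qed (auto simp: coboundary_def cochain_map_def)
qed

lemma cochain_map_diff:
  "cochain_map B f (\<lambda>n \<sigma>. \<phi> n \<sigma> - \<psi> n \<sigma>) = (\<lambda>n \<sigma>. cochain_map B f \<phi> n \<sigma> - cochain_map B f \<psi> n \<sigma>)"
  by (auto simp: cochain_map_def fun_eq_iff)

lemma cochain_map_zero [simp]: "cochain_map B f (\<lambda>n \<sigma>. 0) = (\<lambda>n \<sigma>. 0)"
  by (simp add: cochain_map_def)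

lemma cochain_map_rel_cocycles:
  "map_of_pairs B C X A f \<Longrightarrow> \<phi> \<in> rel_cocycles X A \<Longrightarrow> cochain_map B f \<phi> \<in> rel_cocycles B C"
  using coboundary_cochain_map [of B X f \<phi>]
  by (simp add: rel_cocycles_iff cochain_map_rel_cochains map_of_pairs_def)

text \<open>The union over the representatives collapses: two of them differ by a relative
  coboundary, which is pulled back to a relative coboundary, so all contribute the same
  coset.\<close>

lemma cohomology_map_class:
  assumes f: "map_of_pairs B C X A f"
  shows "cohomology_map B C f (cohomology_class X A \<phi>) = cohomology_class B C (cochain_map B f \<phi>)"
proof -
  have "cohomology_class B C (cochain_map B f \<psi>) = cohomology_class B C (cochain_map B f \<phi>)"
    if \<psi>: "\<psi> \<in> cohomology_class X A \<phi>" for \<psi>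
  proof (rule cohomology_class_eqI)
    obtain \<alpha> where \<alpha>: "\<alpha> \<in> rel_cochains X A" "(\<lambda>n \<sigma>. \<psi> n \<sigma> - \<phi> n \<sigma>) = coboundary X \<alpha>"
      using \<psi> by (auto simp: mem_cohomology_class rel_coboundaries_def)
    have "(\<lambda>n \<sigma>. cochain_map B f \<psi> n \<sigma> - cochain_map B f \<phi> n \<sigma>) = coboundary B (cochain_map B f \<alpha>)"
      using f coboundary_cochain_map [of B X f \<alpha>]
      by (simp add: map_of_pairs_def \<alpha>(2) flip: cochain_map_diff)
    then show "(\<lambda>n \<sigma>. cochain_map B f \<psi> n \<sigma> - cochain_map B f \<phi> n \<sigma>) \<in> rel_coboundaries B C"
      using \<alpha>(1) f by (simp add: rel_coboundaries_def cochain_map_rel_cochains)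
  qed
  then have "(\<Union>\<psi>\<in>cohomology_class X A \<phi>. cohomology_class B C (cochain_map B f \<psi>)) =
      (\<Union>\<psi>\<in>cohomology_class X A \<phi>. cohomology_class B C (cochain_map B f \<phi>))"
    by (intro SUP_cong refl)
  also have "\<dots> = cohomology_class B C (cochain_map B f \<phi>)"
    using cohomology_class_self [of \<phi> X A] by blast
  finally show ?thesis
    by (simp only: cohomology_map_def flip: cohomology_class_def)
qed

section \<open>The prism operator\<close>

text \<open>The combinatorics of the prism, free of topology. Here \<open>a i j\<close> stands for
  the value on the j-th face of the i-th prism simplex and \<open>b i k\<close> for the value on the
  i-th prism simplex over the k-th face of the base. Faces with j < i or j > i + 1 come from faces
  of the base; those with j = i and j = i + 1 are walls shared by neighbours, which telescope to the
  two ends of the prism.\<close>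

lemma prism_sum:
  fixes a b :: "nat \<Rightarrow> nat \<Rightarrow> 'r::{comm_ring,monoid_mult}"
  assumes lower: "\<And>i j. j \<le> i \<Longrightarrow> i < q \<Longrightarrow> a (Suc i) j = b i j"
    and upper: "\<And>i j. i < j \<Longrightarrow> j \<le> q \<Longrightarrow> a i (Suc j) = b i j"
    and diagonal: "\<And>i. i < q \<Longrightarrow> a (Suc i) (Suc i) = a i (Suc i)"
  shows "(\<Sum>i\<le>q. \<Sum>j\<le>Suc q. (- 1) ^ (i + j) * a i j) =
    a 0 0 - a q (Suc q) - (\<Sum>k\<le>q. \<Sum>i<q. (- 1) ^ (i + k) * b i k)"
proof -
  have sq: "(- 1) ^ (i + i) * x = (x::'r)" for i x
    by (simp add: power_add mult.assoc minus_one_power_square)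
  \<comment> \<open>The range of j is cut at i and i + 1. These two terms carry the signs 1 and -1,
    and shifting the range above them by one reverses its sign.\<close>
  have split: "(\<Sum>j\<le>Suc q. (- 1) ^ (i + j) * a i j) =
      (\<Sum>j<i. (- 1) ^ (i + j) * a i j) + (a i i - a i (Suc i)) -
      (\<Sum>j\<in>{Suc i..q}. (- 1) ^ (i + j) * b i j)" if "i \<le> q" for i
  proof -
    have "(\<Sum>j\<in>{Suc (Suc i)..Suc q}. (- 1) ^ (i + j) * a i j) =
        (\<Sum>j\<in>{Suc i..q}. (- 1) ^ (i + Suc j) * a i (Suc j))"
      by (rule sum.atLeast_Suc_atMost_Suc_shift [unfolded o_def])
    also have "\<dots> = - (\<Sum>j\<in>{Suc i..q}. (- 1) ^ (i + j) * b i j)"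
      by (simp add: upper flip: sum_negf)
    moreover have "(\<Sum>j\<le>Suc q. g j) = (\<Sum>j<i. g j) + (g i + g (Suc i)) + (\<Sum>j\<in>{Suc (Suc i)..Suc q}. g j)"
      for g :: "nat \<Rightarrow> 'r"
    proof -
      have "{..Suc q} = ({..<i} \<union> {i, Suc i}) \<union> {Suc (Suc i)..Suc q}"
        using that by auto
      then have "(\<Sum>j\<le>Suc q. g j) = sum g ({..<i} \<union> {i, Suc i}) + (\<Sum>j\<in>{Suc (Suc i)..Suc q}. g j)"
        by (simp only:) (rule sum.union_disjoint; auto)
      also have "sum g ({..<i} \<union> {i, Suc i}) = (\<Sum>j<i. g j) + sum g {i, Suc i}"
        by (rule sum.union_disjoint) auto
      finally show ?thesis
        by simp
    qed
    ultimately show ?thesis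
      by (simp add: sq del: sum.atMost_Suc sum.cl_ivl_Suc)
  qed
  have "(\<Sum>i\<le>q. a i i - a i (Suc i)) = a 0 0 - a q (Suc q)"
  proof -
    \<comment> \<open>The diagonal of \<open>a\<close>, prolonged by one value at q + 1, so that the
      summand i = q also becomes a difference of consecutive values.\<close>
    define c where "c i = (if i \<le> q then a i i else a q (Suc q))" for i
    have "(\<Sum>i\<le>q. a i i - a i (Suc i)) = (\<Sum>i\<le>q. c i - c (Suc i))"
      by (intro sum.cong refl) (auto simp: c_def diagonal not_less_eq_eq)
    also have "\<dots> = c 0 - c (Suc q)"
      by (rule sum_telescope)
    finally show ?thesis
      by (simp add: c_def)
  qed
  moreover have "(\<Sum>i\<le>q. \<Sum>j<i. (- 1) ^ (i + j) * a i j) = - (\<Sum>i<q. \<Sum>j\<le>i. (- 1) ^ (i + j) * b i j)"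
  proof (cases q)
    case (Suc p)
    then have "(\<Sum>i\<le>q. \<Sum>j<i. (- 1) ^ (i + j) * a i j) =
        (\<Sum>i\<le>p. \<Sum>j\<le>i. (- 1) ^ (Suc i + j) * a (Suc i) j)"
      by (simp add: sum.atMost_Suc_shift lessThan_Suc_atMost del: sum.atMost_Suc)
    also have "\<dots> = - (\<Sum>i<q. \<Sum>j\<le>i. (- 1) ^ (i + j) * b i j)"
      by (simp add: Suc lower lessThan_Suc_atMost flip: sum_negf)
    finally show ?thesis .
  qed simp
  \<comment> \<open>For i = q the inner range is empty.\<close>
  moreover have "(\<Sum>i\<le>q. \<Sum>j\<in>{Suc i..q}. (- 1) ^ (i + j) * b i j) =
      (\<Sum>i<q. \<Sum>j\<in>{Suc i..q}. (- 1) ^ (i + j) * b i j)"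
    by (simp flip: lessThan_Suc_atMost)
  moreover have "(\<Sum>k\<le>q. \<Sum>i<q. (- 1) ^ (i + k) * b i k) =
      (\<Sum>i<q. \<Sum>j\<le>i. (- 1) ^ (i + j) * b i j) + (\<Sum>i<q. \<Sum>j\<in>{Suc i..q}. (- 1) ^ (i + j) * b i j)"
  proof -
    have "(\<Sum>j\<le>q. (- 1) ^ (i + j) * b i j) =
        (\<Sum>j\<le>i. (- 1) ^ (i + j) * b i j) + (\<Sum>j\<in>{Suc i..q}. (- 1) ^ (i + j) * b i j)" if "i < q" for i
    proof -
      have "{..q} = {..i} \<union> {Suc i..q}"
        using that by auto
      then show ?thesis
        by (simp add: sum.union_disjoint)
    qed
    then show ?thesis
      by (subst sum.swap) (simp flip: sum.distrib)
  qed
  ultimately show ?thesis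
    by (simp add: split sum.distrib sum_subtractf del: sum.atMost_Suc)
qed

text \<open>In barycentric coordinates, the affine map that identifies the vertices i and i + 1; it
  is the projection of the i-th prism simplex to the base.\<close>

definition degeneracy :: "nat \<Rightarrow> (nat \<Rightarrow> real) \<Rightarrow> nat \<Rightarrow> real" where
  "degeneracy i x k = (if k < i then x k else if k = i then x i + x (Suc i) else x (Suc k))"

definition prism_height :: "nat \<Rightarrow> (nat \<Rightarrow> real) \<Rightarrow> real" where
  "prism_height i x = 1 - (\<Sum>m\<le>i. x m)"

text \<open>The \<open>i\<close>-th simplex of the prism \<open>\<Delta>\<^sup>n \<times> [0, 1]\<close> has its vertices \<open>0, \<dots>, i\<close> at height \<open>0\<close> and
  \<open>i + 1, \<dots>, n + 1\<close> at height \<open>1\<close>. Its height coordinate is written without the summation bound \<open>n\<close>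
  so that the face relations do not depend on \<open>n\<close>.\<close>

definition prism_simplex ::
  "('b \<times> real \<Rightarrow> 'a) \<Rightarrow> nat \<Rightarrow> nat \<Rightarrow> ((nat \<Rightarrow> real) \<Rightarrow> 'b) \<Rightarrow> (nat \<Rightarrow> real) \<Rightarrow> 'a" where
  "prism_simplex H n i \<sigma> =
     restrict (\<lambda>x. H (\<sigma> (degeneracy i x), prism_height i x)) (standard_simplex (Suc n))"

lemma degeneracy_in_standard_simplex:
  assumes x: "x \<in> standard_simplex (Suc n)" and "i \<le> n"
  shows "degeneracy i x \<in> standard_simplex n"
proof -
  have sum: "(\<Sum>k\<le>n. degeneracy i x k) = 1"
  proof -
    \<comment> \<open>Coordinate i of the degeneracy is shared out: x i goes to the first sum, x (i
      + 1) to the second.\<close>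
    have "(\<Sum>k\<le>n. degeneracy i x k) =
        (\<Sum>k\<le>n. if k < i then x k else if k = i then x i else 0) +
        (\<Sum>k\<le>n. if k < i then 0 else x (Suc k))"
      unfolding sum.distrib [symmetric] by (intro sum.cong) (auto simp: degeneracy_def)
    also have "(\<Sum>k\<le>n. if k < i then x k else if k = i then x i else 0) = (\<Sum>k\<le>i. x k)"
      using \<open>i \<le> n\<close> by (intro sum.mono_neutral_cong_right) auto
    also have "(\<Sum>k\<le>n. if k < i then 0 else x (Suc k)) = (\<Sum>k\<in>{i..n}. x (Suc k))"
      using \<open>i \<le> n\<close> by (intro sum.mono_neutral_cong_right) auto
    also have "\<dots> = (\<Sum>k\<in>{Suc i..Suc n}. x k)"
      by (simp only: sum.atLeast_Suc_atMost_Suc_shift o_def)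
    also have "(\<Sum>k\<le>i. x k) + \<dots> = (\<Sum>k\<le>Suc n. x k)"
    proof -
      have "{..Suc n} = {..i} \<union> {Suc i..Suc n}"
        using \<open>i \<le> n\<close> by auto
      then show ?thesis
        by (simp add: sum.union_disjoint del: sum.atMost_Suc)
    qed
    finally show ?thesis
      using x by (simp add: standard_simplex_def)
  qed
  moreover have nonneg: "0 \<le> degeneracy i x k" for k
    using x by (simp add: degeneracy_def standard_simplex_def)
  moreover have zero: "degeneracy i x k = 0" if "k > n" for k
    using x that \<open>i \<le> n\<close> by (simp add: degeneracy_def standard_simplex_def)
  moreover have "degeneracy i x k \<le> 1" for k
    using member_le_sum [of k "{..n}" "degeneracy i x"] nonneg sum zero [of k]
    by (cases "k \<le> n") auto
  ultimately show ?thesis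
    by (simp add: standard_simplex_def)
qed

lemma prism_height_in_unit_interval:
  assumes x: "x \<in> standard_simplex (Suc n)" and "i \<le> n"
  shows "prism_height i x \<in> {0..1}"
proof -
  have "(\<Sum>m\<le>i. x m) \<le> (\<Sum>m\<le>Suc n. x m)"
    using assms by (intro sum_mono2) (auto simp: standard_simplex_def)
  moreover have "0 \<le> (\<Sum>m\<le>i. x m)"
    using assms by (intro sum_nonneg) (auto simp: standard_simplex_def)
  ultimately show ?thesis
    using x by (simp add: prism_height_def standard_simplex_def)
qed

lemma singular_simplex_prism_simplex:
  assumes H: "continuous_map (prod_topology Y (top_of_set {0..1})) X H"
    and \<sigma>: "singular_simplex n Y \<sigma>" and "i \<le> n"
  shows "singular_simplex (Suc n) X (prism_simplex H n i \<sigma>)"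
proof -
  let ?D = "\<lambda>p. subtopology (powertop_real UNIV) (standard_simplex p)"
  have "continuous_map (?D (Suc n)) (?D n) (degeneracy i)"
  proof (rule continuous_map_standard_simplex)
    show "continuous_map (powertop_real UNIV) euclideanreal (\<lambda>x. degeneracy i x k)" for k
      by (auto simp: degeneracy_def intro!: continuous_map_product_projection continuous_map_add)
  qed (use \<open>i \<le> n\<close> degeneracy_in_standard_simplex in blast)
  then have 1: "continuous_map (?D (Suc n)) Y (\<lambda>x. \<sigma> (degeneracy i x))"
    using \<sigma> continuous_map_compose [of "?D (Suc n)" "?D n" "degeneracy i" Y \<sigma>]
    by (simp add: singular_simplex_def o_def)
  have "continuous_map (powertop_real UNIV) euclideanreal (prism_height i)"
    unfolding prism_height_def
    by (intro continuous_map_diff continuous_map_sum continuous_map_product_projection) auto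
  then have 2: "continuous_map (?D (Suc n)) (top_of_set {0..1}) (prism_height i)"
    using \<open>i \<le> n\<close> prism_height_in_unit_interval
    by (auto simp: continuous_map_in_subtopology intro: continuous_map_from_subtopology)
  have "continuous_map (?D (Suc n)) X (\<lambda>x. H (\<sigma> (degeneracy i x), prism_height i x))"
    using continuous_map_compose [OF _ H, of "?D (Suc n)" "\<lambda>x. (\<sigma> (degeneracy i x), prism_height i x)"] 1 2
    by (simp add: continuous_map_pairwise o_def)
  then show ?thesis
    by (simp add: singular_simplex_def prism_simplex_def)
qed

section \<open>Faces of the prism simplices\<close>

lemma degeneracy_simplical_face_lower:
  "j \<le> i \<Longrightarrow> degeneracy (Suc i) (simplical_face j x) = simplical_face j (degeneracy i x)"
  by (auto simp: degeneracy_def simplical_face_def fun_eq_iff)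

lemma degeneracy_simplical_face_same:
  "j = i \<or> j = Suc i \<Longrightarrow> degeneracy i (simplical_face j x) = x"
  by (auto simp: degeneracy_def simplical_face_def fun_eq_iff)

lemma degeneracy_simplical_face_upper:
  "i < j \<Longrightarrow> degeneracy i (simplical_face (Suc j) x) = simplical_face j (degeneracy i x)"
  by (auto simp: degeneracy_def simplical_face_def fun_eq_iff)

text \<open>The zero inserted at position j is among the entries 0, ..., i, so only the first i
  coordinates of x contribute.\<close>

lemma sum_simplical_face_lower:
  assumes "j \<le> i"
  shows "(\<Sum>m\<le>i. simplical_face j x m) = (\<Sum>m<i. x m)"
  using assms
proof (induction i)
  case (Suc i)
  show ?case
  proof (cases "j = Suc i")
    case True
    have "(\<Sum>m\<le>i. simplical_face j x m) = (\<Sum>m\<le>i. x m)"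
      by (intro sum.cong) (auto simp: simplical_face_def True)
    then show ?thesis
      by (simp add: True simplical_face_def lessThan_Suc_atMost)
  qed (use Suc in \<open>simp add: simplical_face_def\<close>)
qed (simp add: simplical_face_def)

lemma prism_height_simplical_face_lower:
  "j \<le> Suc i \<Longrightarrow> prism_height (Suc i) (simplical_face j x) = prism_height i x"
  by (simp only: prism_height_def sum_simplical_face_lower lessThan_Suc_atMost)

lemma prism_height_simplical_face_upper:
  "i < j \<Longrightarrow> prism_height i (simplical_face j x) = prism_height i x"
  by (simp add: prism_height_def simplical_face_def)

lemma singular_face_prism_simplex:
  assumes "j \<le> Suc n"
  shows "singular_face (Suc n) j (prism_simplex H n i \<sigma>) = restrict
    (\<lambda>x. H (\<sigma> (degeneracy i (simplical_face j x)), prism_height i (simplical_face j x)))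
    (standard_simplex n)"
  using simplical_face_in_standard_simplex [of "Suc n" j] assms
  by (auto simp: singular_face_def prism_simplex_def fun_eq_iff)

lemma singular_face_prism_simplex_lower:
  assumes "j \<le> i" "i < n"
  shows "singular_face (Suc n) j (prism_simplex H n (Suc i) \<sigma>) =
    prism_simplex H (n - 1) i (singular_face n j \<sigma>)"
proof -
  have "n - 1 \<ge> i" "Suc (n - 1) = n"
    using assms by auto
  then show ?thesis
    using assms degeneracy_in_standard_simplex [of _ "n - 1" i]
    by (simp add: singular_face_prism_simplex degeneracy_simplical_face_lower
        prism_height_simplical_face_lower)
      (auto simp: prism_simplex_def singular_face_def fun_eq_iff)
qed

lemma singular_face_prism_simplex_upper:
  assumes "i < j" "j \<le> n"
  shows "singular_face (Suc n) (Suc j) (prism_simplex H n i \<sigma>) =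
    prism_simplex H (n - 1) i (singular_face n j \<sigma>)"
proof -
  have "n - 1 \<ge> i" "Suc (n - 1) = n"
    using assms by auto
  then show ?thesis
    using assms degeneracy_in_standard_simplex [of _ "n - 1" i]
    by (simp add: singular_face_prism_simplex degeneracy_simplical_face_upper
        prism_height_simplical_face_upper)
      (auto simp: prism_simplex_def singular_face_def fun_eq_iff)
qed

text \<open>The wall between neighbouring prism simplices: from either side the degeneracy undoes
  the face map and the height is \<open>prism_height i\<close>.\<close>

lemma singular_face_prism_simplex_diagonal:
  "i < n \<Longrightarrow> singular_face (Suc n) (Suc i) (prism_simplex H n (Suc i) \<sigma>) =
    singular_face (Suc n) (Suc i) (prism_simplex H n i \<sigma>)"
  by (simp add: singular_face_prism_simplex degeneracy_simplical_face_same
      prism_height_simplical_face_lower prism_height_simplical_face_upper)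

text \<open>Vertex 0 is the only vertex of the first prism simplex at height 0, so deleting it
  leaves the top. In the next lemma, deleting the only vertex of the last prism simplex at height 1
  leaves the bottom.\<close>

lemma singular_face_prism_simplex_first:
  "singular_face (Suc n) 0 (prism_simplex H n 0 \<sigma>) = simplex_map n (\<lambda>y. H (y, 1)) \<sigma>"
  by (simp add: singular_face_prism_simplex degeneracy_simplical_face_same prism_height_def)
    (simp add: simplical_face_def simplex_map_def o_def)

lemma singular_face_prism_simplex_last:
  "singular_face (Suc n) (Suc n) (prism_simplex H n n \<sigma>) = simplex_map n (\<lambda>y. H (y, 0)) \<sigma>"
  by (auto simp: singular_face_prism_simplex degeneracy_simplical_face_same
      prism_height_simplical_face_upper simplex_map_def fun_eq_iff)
    (simp add: prism_height_def standard_simplex_def)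

definition prism_cochain ::
  "('b \<times> real \<Rightarrow> 'a) \<Rightarrow> ('a, 'r::{comm_ring,monoid_mult}) cochain \<Rightarrow> ('b, 'r) cochain" where
  "prism_cochain H \<phi> n \<sigma> = (\<Sum>i\<le>n. (- 1) ^ i * \<phi> (Suc n) (prism_simplex H n i \<sigma>))"

text \<open>The usual homotopy formula, without the term in the coboundary of \<phi> because \<phi>
  is a cocycle. It results from adding, with alternating signs, the zero values of that coboundary
  on all prism simplices.\<close>

lemma coboundary_prism_cochain:
  fixes \<phi> :: "('a, 'r::{comm_ring,monoid_mult}) cochain"
  assumes H: "continuous_map (prod_topology Y (top_of_set {0..1})) X H"
    and \<sigma>: "singular_simplex n Y \<sigma>" and \<phi>: "coboundary X \<phi> = (\<lambda>n \<sigma>. 0)"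
  shows "coboundary Y (prism_cochain H \<phi>) n \<sigma> =
    \<phi> n (simplex_map n (\<lambda>y. H (y, 1)) \<sigma>) - \<phi> n (simplex_map n (\<lambda>y. H (y, 0)) \<sigma>)"
proof -
  define a where "a i j = \<phi> n (singular_face (Suc n) j (prism_simplex H n i \<sigma>))" for i j
  define b where "b i j = \<phi> n (prism_simplex H (n - 1) i (singular_face n j \<sigma>))" for i j
  have "(\<Sum>j\<le>Suc n. (- 1) ^ j * a i j) = 0" if "i \<le> n" for i
    using fun_cong [OF fun_cong [OF \<phi>], of "Suc n" "prism_simplex H n i \<sigma>"]
      singular_simplex_prism_simplex [OF H \<sigma> that]
    by (simp add: coboundary_def a_def del: sum.atMost_Suc)
  then have "(\<Sum>i\<le>n. \<Sum>j\<le>Suc n. (- 1) ^ (i + j) * a i j) = 0"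
    by (simp add: power_add mult.assoc del: sum.atMost_Suc flip: sum_distrib_left)
  moreover have "(\<Sum>i\<le>n. \<Sum>j\<le>Suc n. (- 1) ^ (i + j) * a i j) =
      a 0 0 - a n (Suc n) - (\<Sum>k\<le>n. \<Sum>i<n. (- 1) ^ (i + k) * b i k)"
    by (intro prism_sum)
      (simp_all add: a_def b_def singular_face_prism_simplex_lower
        singular_face_prism_simplex_upper singular_face_prism_simplex_diagonal)
  moreover have "(\<Sum>k\<le>n. \<Sum>i<n. (- 1) ^ (i + k) * b i k) = coboundary Y (prism_cochain H \<phi>) n \<sigma>"
  proof (cases n)
    case (Suc m)
    show ?thesis
      using \<sigma> by (simp add: coboundary_def prism_cochain_def b_def Suc power_add sum_distrib_left
          lessThan_Suc_atMost mult_ac del: sum.atMost_Suc)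
  qed (simp add: coboundary_def)
  ultimately show ?thesis
    by (simp add: a_def singular_face_prism_simplex_first singular_face_prism_simplex_last)
qed

section \<open>Cocycles vanishing on small simplices\<close>

lemma singular_chain_singular_subdivision_power:
  "singular_chain p X c \<Longrightarrow> singular_chain p X ((singular_subdivision p ^^ m) c)"
  by (induction m) (simp_all add: singular_chain_singular_subdivision)

lemma chain_boundary_singular_subdivision_power:
  assumes "singular_chain p X c"
  shows "chain_boundary p ((singular_subdivision p ^^ m) c) =
    (singular_subdivision (p - 1) ^^ m) (chain_boundary p c)"
proof (induction m)
  case (Suc m)
  then show ?case
    using chain_boundary_singular_subdivision
      [OF singular_chain_singular_subdivision_power [OF assms]] by simp
qed simp

text \<open>Meant for the composite of the subdivision homotopy with iterated subdivision, for which
  the two assumptions are what is at hand; they already give compatibility with signs and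
  sums.\<close>

lemma linear_frag_sum:
  fixes T :: "('s \<Rightarrow>\<^sub>0 int) \<Rightarrow> ('t \<Rightarrow>\<^sub>0 int)"
  assumes "T 0 = 0" "\<And>a b. T (a - b) = T a - T b"
  shows "T (frag_cmul ((- 1) ^ k) a) = frag_cmul ((- 1) ^ k) (T a)"
    and "T (sum g I) = (\<Sum>i\<in>I. T (g i))"
proof -
  have minus: "T (- a) = - T a" for a
    using assms(2) [of 0 a] by (simp add: assms(1))
  show "T (frag_cmul ((- 1) ^ k) a) = frag_cmul ((- 1) ^ k) (T a)"
    by (cases "even k") (simp_all add: minus)
  have "T (a + b) = T a + T b" for a b
    using assms(2) [of a "- b"] by (simp add: minus)
  then show "T (sum g I) = (\<Sum>i\<in>I. T (g i))"
    by (induction I rule: infinite_finite_induct) (simp_all add: assms(1))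
qed

lemma vanishes_on_chain_eval:
  "vanishes_on X U \<phi> \<Longrightarrow> singular_chain n (subtopology X U) c \<Longrightarrow> chain_eval (\<phi> n) c = 0"
  by (rule chain_eval_eq_0) (auto simp: vanishes_on_def singular_chain_def)

text \<open>With \<open>h\<close> the chain homotopy from the identity to the subdivision \<open>S\<close>, a primitive is
  \<open>\<sigma> \<mapsto> - (\<Sum>i. \<phi> (h (S\<^sup>i \<sigma>)))\<close>: the sum is finite because \<open>S\<^sup>i \<sigma>\<close>, and hence \<open>h (S\<^sup>i \<sigma>)\<close>, is
  eventually small, and its coboundary telescopes. It is relative since \<open>h\<close> and \<open>S\<close> preserve \<open>C\<close>.\<close>

proposition small_cocycle_imp_coboundary:
  fixes \<phi> :: "('b, 'r::{comm_ring,monoid_mult}) cochain"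
  assumes \<phi>: "\<phi> \<in> rel_cocycles B C"
    and opn: "\<And>U. U \<in> \<C> \<Longrightarrow> openin B U" and cover: "\<Union>\<C> = topspace B"
    and small: "\<And>U. U \<in> \<C> \<Longrightarrow> vanishes_on B U \<phi>"
  shows "\<phi> \<in> rel_coboundaries B C"
proof -
  \<comment> \<open>A single \<open>h\<close> serves all spaces at once. It therefore preserves the
    chains of the members of the cover and of C along with those of B.\<close>
  obtain h :: "nat \<Rightarrow> 'b chain \<Rightarrow> 'b chain" where h0: "\<And>p. h p 0 = 0"
    and hdiff: "\<And>p c1 c2. h p (c1 - c2) = h p c1 - h p c2"
    and hchain: "\<And>p X c. singular_chain p X c \<Longrightarrow> singular_chain (Suc p) X (h p c)"
    and hhom: "\<And>p X c. singular_chain p X c \<Longrightarrow>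
      chain_boundary (Suc p) (h p c) + h (p - Suc 0) (chain_boundary p c) = singular_subdivision p c - c"
    using chain_homotopic_singular_subdivision by metis
  let ?S = "\<lambda>p m. singular_subdivision p ^^ m"
  define T where "T p i c = chain_eval (\<phi> (Suc p)) (h p (?S p i c))" for p i c
  have \<phi>C: "vanishes_on B C \<phi>" and \<phi>fin: "finite {n. \<phi> n \<noteq> (\<lambda>\<sigma>. 0)}"
    and \<phi>off: "\<And>n \<sigma>. \<not> singular_simplex n B \<sigma> \<Longrightarrow> \<phi> n \<sigma> = 0"
    and \<phi>cocycle: "coboundary B \<phi> = (\<lambda>n \<sigma>. 0)"
    using \<phi> by (auto simp: rel_cocycles_def rel_cochains_def vanishes_on_def)
  \<comment> \<open>Different simplices of c may lie in different members of the cover, hence the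
    reduction to single simplices. The first conjunct makes the sum for the primitive finite; the
    second removes the upper end of the telescope.\<close>
  have vanish: "chain_eval (\<phi> (Suc p)) (h p c) = 0 \<and> chain_eval (\<phi> p) c = 0"
    if c: "singular_chain p B c" "\<And>f. f \<in> Poly_Mapping.keys c \<Longrightarrow> \<exists>V\<in>\<C>. f \<in> standard_simplex p \<rightarrow> V" for p c
  proof -
    have "Poly_Mapping.keys c \<subseteq> {f. \<exists>V\<in>\<C>. singular_simplex p (subtopology B V) f}"
    proof
      fix f
      assume f: "f \<in> Poly_Mapping.keys c"
      then have "singular_simplex p B f"
        using c(1) by (auto simp: singular_chain_def)
      with c(2) [OF f] show "f \<in> {f. \<exists>V\<in>\<C>. singular_simplex p (subtopology B V) f}"
        by (auto simp: singular_simplex_subtopology)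
    qed
    then show ?thesis
    proof (induction rule: frag_induction)
      case (one f)
      then obtain V where "V \<in> \<C>" and V: "singular_chain p (subtopology B V) (frag_of f)"
        by (auto simp: singular_chain_of)
      show ?case
        by (intro conjI vanishes_on_chain_eval [OF small [OF \<open>V \<in> \<C>\<close>]] hchain V)
    qed (simp_all add: h0 hdiff chain_eval_diff)
  qed
  define stable where "stable p \<sigma> N \<longleftrightarrow>
      (\<forall>m\<ge>N. T p m (frag_of \<sigma>) = 0 \<and> chain_eval (\<phi> p) (?S p m (frag_of \<sigma>)) = 0)" for p \<sigma> N
  define N where "N p \<sigma> = (SOME N. stable p \<sigma> N)" for p \<sigma>
  have ex: "\<exists>N. stable p \<sigma> N"
    if "singular_simplex p B \<sigma>" for p \<sigma>
  proof -
    have c: "singular_chain p B (frag_of \<sigma>)"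
      using that by (simp add: singular_chain_of)
    obtain N' where N': "\<And>m f. N' \<le> m \<Longrightarrow> f \<in> Poly_Mapping.keys (?S p m (frag_of \<sigma>)) \<Longrightarrow>
        \<exists>V\<in>\<C>. f \<in> standard_simplex p \<rightarrow> V"
    proof (rule sufficient_iterated_singular_subdivision_exists [OF opn equalityD2 [OF cover] c])
      fix N'
      assume "\<And>m f. N' \<le> m \<Longrightarrow> f \<in> Poly_Mapping.keys (?S p m (frag_of \<sigma>)) \<Longrightarrow>
        \<exists>V\<in>\<C>. f \<in> standard_simplex p \<rightarrow> V"
      then show thesis
        by (rule that)
    qed
    have "stable p \<sigma> N'"
      unfolding stable_def T_def
      by (intro allI impI vanish singular_chain_singular_subdivision_power [OF c] N')
    then show ?thesis ..
  qed
  have "stable p \<sigma> (N p \<sigma>)" if "singular_simplex p B \<sigma>" for p \<sigma>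
    unfolding N_def using someI_ex [OF ex [OF that]] .
  then have N: "T p m (frag_of \<sigma>) = 0 \<and> chain_eval (\<phi> p) (?S p m (frag_of \<sigma>)) = 0"
    if "singular_simplex p B \<sigma>" "N p \<sigma> \<le> m" for p \<sigma> m
    using that unfolding stable_def by simp
  define \<eta> where "\<eta> p \<sigma> = (if singular_simplex p B \<sigma> then - (\<Sum>i<N p \<sigma>. T p i (frag_of \<sigma>)) else 0)" for p \<sigma>
  \<comment> \<open>All terms from the threshold on vanish, so any larger upper limit gives the same
    value. This allows a common limit for faces whose thresholds differ.\<close>
  have \<eta>: "\<eta> p \<sigma> = - (\<Sum>i<M. T p i (frag_of \<sigma>))" if "singular_simplex p B \<sigma>" "N p \<sigma> \<le> M" for p \<sigma> M
  proof -
    have "(\<Sum>i<N p \<sigma>. T p i (frag_of \<sigma>)) = (\<Sum>i<M. T p i (frag_of \<sigma>))"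
      using that N by (intro sum.mono_neutral_left) auto
    then show ?thesis
      using that by (simp add: \<eta>_def)
  qed
  have "\<phi> = coboundary B \<eta>"
  proof (intro ext)
    fix n and \<sigma> :: "(nat \<Rightarrow> real) \<Rightarrow> 'b"
    consider "\<not> singular_simplex n B \<sigma>" | "singular_simplex n B \<sigma>" "n = 0"
      | p where "singular_simplex n B \<sigma>" "n = Suc p"
      by (cases n) auto
    then show "\<phi> n \<sigma> = coboundary B \<eta> n \<sigma>"
    proof cases
      case 1
      then show ?thesis
        by (simp add: \<phi>off coboundary_def)
    next
      case 2
      \<comment> \<open>The only point of the standard 0-simplex. Every 0-simplex lies in a member
        of the cover, so \<phi> is zero in degree 0, where every coboundary is zero by
        definition.\<close>
      let ?x = "\<lambda>j. if j = 0 then 1 else 0 :: real"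
      have "\<sigma> ?x \<in> topspace B"
        using 2 by (auto simp: singular_simplex_def continuous_map_def standard_simplex_0)
      then obtain U where "U \<in> \<C>" "\<sigma> ?x \<in> U"
        using cover by blast
      then have "singular_simplex 0 (subtopology B U) \<sigma>"
        using 2 by (simp add: singular_simplex_subtopology standard_simplex_0)
      then show ?thesis
        using small [OF \<open>U \<in> \<C>\<close>] by (simp add: 2 vanishes_on_def coboundary_def)
    next
      case 3
      let ?c = "frag_of \<sigma>"
      have c: "singular_chain (Suc p) B ?c"
        using 3 by (simp add: singular_chain_of)
      have face: "singular_simplex p B (singular_face n k \<sigma>)" if "k \<le> n" for k
        using singular_simplex_singular_face [of n B \<sigma> k] 3 that by simp
      \<comment> \<open>The faces are included to give their sums equal length, \<sigma> itself
        because the telescope ends at its M-fold subdivision, where \<phi> has to vanish.\<close>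
      define M where "M = Max (insert (N n \<sigma>) ((\<lambda>k. N p (singular_face n k \<sigma>)) ` {..n}))"
      have M: "N n \<sigma> \<le> M" "\<And>k. k \<le> n \<Longrightarrow> N p (singular_face n k \<sigma>) \<le> M"
        unfolding M_def by (rule Max_ge; simp)+
      \<comment> \<open>The homotopy formula for the i-fold subdivision of \<sigma>, paired with
        \<phi>: the boundary term contributes the coboundary of \<phi>, which is zero, and the
        difference of two consecutive subdivisions remains.\<close>
      have step: "T p i (chain_boundary n ?c) =
          chain_eval (\<phi> n) (?S n (Suc i) ?c) - chain_eval (\<phi> n) (?S n i ?c)" for i
      proof -
        let ?d = "?S n i ?c"
        have d: "singular_chain n B ?d"
          using c 3 by (simp add: singular_chain_singular_subdivision_power)
        have "?S p i (chain_boundary n ?c) = chain_boundary n ?d"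
          using chain_boundary_singular_subdivision_power [OF c, of i] 3 by simp
        then have "h p (?S p i (chain_boundary n ?c)) =
            ?S n (Suc i) ?c - ?d - chain_boundary (Suc n) (h n ?d)"
          using hhom [OF d] 3 by (simp add: algebra_simps)
        moreover have "chain_eval (\<phi> n) (chain_boundary (Suc n) (h n ?d)) = 0"
          using coboundary_chain_eval [OF hchain [OF d], of \<phi>] by (simp add: \<phi>cocycle)
        ultimately show ?thesis
          using 3 by (simp add: T_def chain_eval_diff)
      qed
      have T_sum: "T p i (chain_boundary n ?c) = (\<Sum>k\<le>n. (- 1) ^ k * T p i (frag_of (singular_face n k \<sigma>)))" for i
      proof -
        have "h p (?S p i (chain_boundary n ?c)) =
            (\<Sum>k\<le>n. frag_cmul ((- 1) ^ k) (h p (?S p i (frag_of (singular_face n k \<sigma>)))))"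
          using 3 linear_frag_sum(1) [where T = "\<lambda>c. h p (?S p i c)"]
            linear_frag_sum(2) [where T = "\<lambda>c. h p (?S p i c)" and I = "{..n}"]
          by (simp add: chain_boundary_of h0 hdiff singular_subdivision_power_diff del: sum.atMost_Suc)
        then show ?thesis
          by (simp add: T_def chain_eval_sum chain_eval_sign)
      qed
      have "coboundary B \<eta> n \<sigma> = (\<Sum>k\<le>n. (- 1) ^ k * - (\<Sum>i<M. T p i (frag_of (singular_face n k \<sigma>))))"
      proof -
        have \<eta>_face: "\<eta> p (singular_face n k \<sigma>) = - (\<Sum>i<M. T p i (frag_of (singular_face n k \<sigma>)))"
          if "k \<le> n" for k
          using that by (intro \<eta> face M)
        from 3 have "coboundary B \<eta> n \<sigma> = (\<Sum>k\<le>n. (- 1) ^ k * \<eta> p (singular_face n k \<sigma>))"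
          by (simp add: coboundary_def del: sum.atMost_Suc)
        also have "\<dots> = (\<Sum>k\<le>n. (- 1) ^ k * - (\<Sum>i<M. T p i (frag_of (singular_face n k \<sigma>))))"
          by (intro sum.cong refl) (simp add: \<eta>_face)
        finally show ?thesis .
      qed
      also have "\<dots> = - (\<Sum>k\<le>n. \<Sum>i<M. (- 1) ^ k * T p i (frag_of (singular_face n k \<sigma>)))"
        by (simp add: sum_distrib_left sum_negf del: sum.atMost_Suc)
      also have "\<dots> = - (\<Sum>i<M. T p i (chain_boundary n ?c))"
        unfolding T_sum by (subst sum.swap) simp
      also have "\<dots> = - (chain_eval (\<phi> n) (?S n M ?c) - chain_eval (\<phi> n) ?c)"
        unfolding step
        by (subst sum_lessThan_telescope [of "\<lambda>i. chain_eval (\<phi> n) (?S n i ?c)"]) simp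
      also have "\<dots> = \<phi> n \<sigma>"
        using N [of n \<sigma> M] M 3 by simp
      finally show ?thesis ..
    qed
  qed
  moreover have "\<eta> \<in> rel_cochains B C"
  proof -
    have "{n. \<eta> n \<noteq> (\<lambda>\<sigma>. 0)} \<subseteq> (\<lambda>n. n - 1) ` {n. \<phi> n \<noteq> (\<lambda>\<sigma>. 0)}"
    proof
      fix n
      assume "n \<in> {n. \<eta> n \<noteq> (\<lambda>\<sigma>. 0)}"
      moreover have "\<eta> n = (\<lambda>\<sigma>. 0)" if "\<phi> (Suc n) = (\<lambda>\<sigma>. 0)"
        by (simp add: \<eta>_def T_def that fun_eq_iff)
      ultimately show "n \<in> (\<lambda>n. n - 1) ` {n. \<phi> n \<noteq> (\<lambda>\<sigma>. 0)}"
        by (intro image_eqI [where x = "Suc n"]) auto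
    qed
    moreover have "\<eta> n \<sigma> = 0" if "singular_simplex n (subtopology B C) \<sigma>" for n \<sigma>
    proof -
      have "T n i (frag_of \<sigma>) = 0" for i
        using that unfolding T_def
        by (intro vanishes_on_chain_eval [OF \<phi>C] hchain singular_chain_singular_subdivision_power)
          (simp add: singular_chain_of)
      then show ?thesis
        by (simp add: \<eta>_def)
    qed
    ultimately show ?thesis
      using \<phi>fin by (auto simp: rel_cochains_def \<eta>_def intro: finite_subset)
  qed
  ultimately show ?thesis
    by (auto simp: rel_coboundaries_def)
qed

section \<open>The nilpotency bound\<close>

lemma strongly_relatively_inessential_imp_cobounding:
  fixes \<phi> :: "('a, 'r::{comm_ring,monoid_mult}) cochain"
  assumes f: "map_of_pairs B C X A f" and \<phi>: "\<phi> \<in> rel_cocycles X A"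
    and U: "strongly_relatively_inessential (subtopology B U) (U \<inter> C) X A f"
  obtains \<psi> where "\<psi> \<in> rel_cochains B C"
    and "vanishes_on B U (\<lambda>n \<sigma>. cochain_map B f \<phi> n \<sigma> - coboundary B \<psi> n \<sigma>)"
proof -
  let ?Y = "subtopology B U"
  obtain H where H: "continuous_map (prod_topology ?Y (top_of_set {0..1::real})) X H"
    and H1: "\<forall>b\<in>topspace ?Y. H (b, 1) = f b"
    and H0: "\<forall>b\<in>topspace ?Y. H (b, 0) \<in> A"
    and HC': "\<forall>c\<in>U \<inter> C. \<forall>t\<in>{0..1}. H (c, t) = f c \<and> f c \<in> A"
    using U unfolding strongly_relatively_inessential_def by blast
  from HC' have HC: "H (c, t) \<in> A" if "c \<in> U \<inter> C" "t \<in> {0..1}" for c t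
    using that by metis
  have \<phi>A: "\<And>n \<sigma>. singular_simplex n (subtopology X A) \<sigma> \<Longrightarrow> \<phi> n \<sigma> = 0"
    and \<phi>fin: "finite {n. \<phi> n \<noteq> (\<lambda>\<sigma>. 0)}"
    using \<phi> by (auto simp: rel_cocycles_def rel_cochains_def)
  define \<psi> where "\<psi> n \<sigma> = (if singular_simplex n ?Y \<sigma> then prism_cochain H \<phi> n \<sigma> else 0)" for n \<sigma>
  have "\<psi> \<in> rel_cochains B C"
  proof -
    have "{n. \<psi> n \<noteq> (\<lambda>\<sigma>. 0)} \<subseteq> (\<lambda>n. n - 1) ` {n. \<phi> n \<noteq> (\<lambda>\<sigma>. 0)}"
    proof
      fix n
      assume "n \<in> {n. \<psi> n \<noteq> (\<lambda>\<sigma>. 0)}"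
      moreover have "\<psi> n = (\<lambda>\<sigma>. 0)" if "\<phi> (Suc n) = (\<lambda>\<sigma>. 0)"
        by (simp add: \<psi>_def prism_cochain_def that fun_eq_iff)
      ultimately show "n \<in> (\<lambda>n. n - 1) ` {n. \<phi> n \<noteq> (\<lambda>\<sigma>. 0)}"
        by (intro image_eqI [where x = "Suc n"]) auto
    qed
    moreover have "\<psi> n \<sigma> = 0" if \<sigma>: "singular_simplex n (subtopology B C) \<sigma>" for n \<sigma>
    proof (cases "singular_simplex n ?Y \<sigma>")
      case True
      have "\<sigma> x \<in> U \<inter> C" if "x \<in> standard_simplex n" for x
        using True \<sigma> that by (auto simp: singular_simplex_subtopology)
      then have "prism_simplex H n i \<sigma> ` standard_simplex (Suc n) \<subseteq> A" if "i \<le> n" for i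
        using that HC degeneracy_in_standard_simplex prism_height_in_unit_interval
        by (auto simp: prism_simplex_def)
      then have "singular_simplex (Suc n) (subtopology X A) (prism_simplex H n i \<sigma>)" if "i \<le> n" for i
        using that singular_simplex_prism_simplex [OF H True]
        by (simp add: singular_simplex_subtopology)
      then show ?thesis
        by (simp add: \<psi>_def prism_cochain_def \<phi>A)
    qed (simp add: \<psi>_def)
    moreover have "\<psi> n \<sigma> = 0" if "\<not> singular_simplex n B \<sigma>" for n \<sigma>
      using that by (simp add: \<psi>_def singular_simplex_subtopology)
    ultimately show ?thesis
      using \<phi>fin by (auto simp: rel_cochains_def intro: finite_subset)
  qed
  moreover have "vanishes_on B U (\<lambda>n \<sigma>. cochain_map B f \<phi> n \<sigma> - coboundary B \<psi> n \<sigma>)"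
    unfolding vanishes_on_def
  proof (intro allI impI)
    fix n \<sigma>
    assume \<sigma>: "singular_simplex n ?Y \<sigma>"
    then have \<sigma>B: "singular_simplex n B \<sigma>"
      by (simp add: singular_simplex_subtopology)
    \<comment> \<open>All faces of a simplex in U lie in U, so the extension by zero is invisible to
      the coboundary there.\<close>
    have "coboundary B \<psi> n \<sigma> = coboundary ?Y (prism_cochain H \<phi>) n \<sigma>"
    proof (cases n)
      case (Suc m)
      then show ?thesis
        using \<sigma> \<sigma>B singular_simplex_singular_face [OF \<sigma>]
        by (simp add: coboundary_def \<psi>_def del: sum.atMost_Suc)
    qed (simp add: coboundary_def)
    also have "\<dots> = \<phi> n (simplex_map n (\<lambda>y. H (y, 1)) \<sigma>) - \<phi> n (simplex_map n (\<lambda>y. H (y, 0)) \<sigma>)"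
      using \<phi> by (intro coboundary_prism_cochain [OF H \<sigma>]) (simp add: rel_cocycles_def)
    also have "simplex_map n (\<lambda>y. H (y, 1)) \<sigma> = simplex_map n f \<sigma>"
      by (rule simplex_map_eq [OF \<sigma>]) (use H1 in blast)
    \<comment> \<open>At time 0 the homotopy has moved all of U into A, where the relative cochain
      \<phi> vanishes; only the end given by f survives.\<close>
    also have "\<phi> n (simplex_map n (\<lambda>y. H (y, 0)) \<sigma>) = 0"
    proof (rule \<phi>A)
      have "continuous_map ?Y (prod_topology ?Y (top_of_set {0..1::real})) (\<lambda>y. (y, 0))"
        by (simp add: continuous_map_pairwise o_def)
      from continuous_map_compose [OF this H]
      have "continuous_map ?Y (subtopology X A) (\<lambda>y. H (y, 0))"
        using H0 by (auto simp: continuous_map_in_subtopology o_def)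
      then show "singular_simplex n (subtopology X A) (simplex_map n (\<lambda>y. H (y, 0)) \<sigma>)"
        by (rule singular_simplex_simplex_map [OF \<sigma>])
    qed
    finally show "cochain_map B f \<phi> n \<sigma> - coboundary B \<psi> n \<sigma> = 0"
      using \<sigma>B by (simp add: cochain_map_def)
  qed
  ultimately show ?thesis
    by (rule that)
qed

lemma vanishing_representative:
  fixes \<phi> :: "('a, 'r::{comm_ring,monoid_mult}) cochain"
  assumes f: "map_of_pairs B C X A f" and \<phi>: "\<phi> \<in> rel_cocycles X A"
    and U: "strongly_relatively_inessential (subtopology B U) (U \<inter> C) X A f"
  obtains \<theta> where "\<theta> \<in> rel_cocycles B C" "vanishes_on B U \<theta>"
    "cohomology_class B C (cochain_map B f \<phi>) = cohomology_class B C \<theta>"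
proof -
  obtain \<psi> where \<psi>: "\<psi> \<in> rel_cochains B C"
    and van: "vanishes_on B U (\<lambda>n \<sigma>. cochain_map B f \<phi> n \<sigma> - coboundary B \<psi> n \<sigma>)"
    using strongly_relatively_inessential_imp_cobounding [OF assms] by blast
  let ?\<theta> = "\<lambda>n \<sigma>. cochain_map B f \<phi> n \<sigma> - coboundary B \<psi> n \<sigma>"
  have \<beta>: "coboundary B \<psi> \<in> rel_coboundaries B C"
    using \<psi> by (simp add: rel_coboundaries_def)
  then have in_class: "?\<theta> \<in> cohomology_class B C (cochain_map B f \<phi>)"
    using rel_coboundaries_minus by (simp add: mem_cohomology_class)
  show ?thesis
  proof (rule that [OF _ van])
    show "?\<theta> \<in> rel_cocycles B C"
      using in_class cohomology_class_subset [OF cochain_map_rel_cocycles [OF f \<phi>]] by blast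
    show "cohomology_class B C (cochain_map B f \<phi>) = cohomology_class B C ?\<theta>"
      using cohomology_class_eq [OF in_class] by simp
  qed
qed

text \<open>The infimum also demands that the n-th power be nonzero. The least n whose next power is
  zero satisfies this by minimality at n - 1, and it is at most l.\<close>

lemma nilpotency_index_le:
  assumes "ring_power R (l + 1) = {\<zero>\<^bsub>R\<^esub>}"
  shows "nilpotency_index R \<le> enat l"
proof -
  define n where "n = (LEAST n. ring_power R (n + 1) = {\<zero>\<^bsub>R\<^esub>})"
  have n: "ring_power R (n + 1) = {\<zero>\<^bsub>R\<^esub>}" "n \<le> l"
    unfolding n_def using assms by (rule LeastI, rule Least_le)
  have "ring_power R n \<noteq> {\<zero>\<^bsub>R\<^esub>}" if "0 < n"
    using that not_less_Least [of "n - 1" "\<lambda>n. ring_power R (n + 1) = {\<zero>\<^bsub>R\<^esub>}", folded n_def]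
    by simp
  then have "nilpotency_index R \<le> enat n"
    unfolding nilpotency_index_def using n(1) by (intro Inf_lower) blast
  also have "\<dots> \<le> enat l"
    using n(2) by simp
  finally show ?thesis .
qed

lemma cohomology_class_zero: "cohomology_class X A (\<lambda>n \<sigma>. 0) = rel_coboundaries X A"
  by (simp add: cohomology_class_coboundary rel_coboundaries_zero)

lemma zero_add_cohomology_class:
  "rel_coboundaries X A \<oplus>\<^bsub>cohomology_ring X A\<^esub> cohomology_class X A \<phi> = cohomology_class X A \<phi>"
proof
  have "(\<lambda>n \<sigma>. \<alpha> n \<sigma> + \<beta> n \<sigma>) \<in> cohomology_class X A \<phi>"
    if "\<alpha> \<in> rel_coboundaries X A" "\<beta> \<in> cohomology_class X A \<phi>" for \<alpha> \<beta>
    using rel_coboundaries_add [OF that(1), of "\<lambda>n \<sigma>. \<beta> n \<sigma> - \<phi> n \<sigma>"] that(2)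
    by (simp add: mem_cohomology_class add_diff_eq)
  then show "rel_coboundaries X A \<oplus>\<^bsub>cohomology_ring X A\<^esub> cohomology_class X A \<phi> \<subseteq> cohomology_class X A \<phi>"
    by (auto simp: cohomology_ring_simps)
  show "cohomology_class X A \<phi> \<subseteq> rel_coboundaries X A \<oplus>\<^bsub>cohomology_ring X A\<^esub> cohomology_class X A \<phi>"
  proof
    fix \<psi>
    assume "\<psi> \<in> cohomology_class X A \<phi>"
    then have "(\<lambda>n \<sigma>. 0 + \<psi> n \<sigma>) \<in> rel_coboundaries X A \<oplus>\<^bsub>cohomology_ring X A\<^esub> cohomology_class X A \<phi>"
      unfolding cohomology_ring_simps by (intro UN_I [OF rel_coboundaries_zero] UN_I) auto
    then show "\<psi> \<in> rel_coboundaries X A \<oplus>\<^bsub>cohomology_ring X A\<^esub> cohomology_class X A \<phi>"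
      by simp
  qed
qed

text \<open>Stated for a bare record, since only the left identity law is at hand for the additive
  structure of the image. It suffices to evaluate the inverse of z, which is given by a description:
  z \<otimes> y = z forces y = z.\<close>

lemma generate_zero:
  assumes zero: "z = \<one>\<^bsub>G\<^esub>" "z \<in> carrier G" and idem: "\<And>y. y \<in> carrier G \<Longrightarrow> z \<otimes>\<^bsub>G\<^esub> y = y"
    and S: "S \<subseteq> {z}"
  shows "generate G S = {z}"
proof -
  have "inv\<^bsub>G\<^esub> z = z"
    unfolding m_inv_def using zero idem by (intro the_equality) auto
  moreover have "x = z" if "x \<in> generate G S" for x
    using that by (induction rule: generate.induct)
      (use zero idem S \<open>inv\<^bsub>G\<^esub> z = z\<close> in auto)
  moreover have "z \<in> generate G S"
    unfolding zero(1) by (rule generate.one)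
  ultimately show ?thesis
    by blast
qed

proposition cup_product_vanishes:
  fixes \<phi>s :: "('a, 'r::{comm_ring,monoid_mult}) cochain list"
  assumes f: "map_of_pairs B C X A f"
    and opn: "\<And>i. i \<le> l \<Longrightarrow> openin B (U i)" and cover: "(\<Union>i\<le>l. U i) = topspace B"
    and U: "\<And>i. i \<le> l \<Longrightarrow> strongly_relatively_inessential (subtopology B (U i)) (U i \<inter> C) X A f"
    and xs: "set (x # xs) \<subseteq> cohomology_class B C ` cochain_map B f ` rel_cocycles X A"
    and len: "length (x # xs) = l + 1"
  shows "foldl (\<otimes>\<^bsub>cohomology_ring B C\<^esub>) x xs = (rel_coboundaries B C :: ('b, 'r) cochain set)"
proof -
  have "\<exists>\<theta>. \<theta> \<in> rel_cocycles B C \<and> vanishes_on B (U i) \<theta> \<and> (x # xs) ! i = cohomology_class B C \<theta>"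
    if "i \<le> l" for i
  proof -
    have "(x # xs) ! i \<in> set (x # xs)"
      using that len by (intro nth_mem) simp
    then obtain \<phi> where \<phi>: "\<phi> \<in> rel_cocycles X A" "(x # xs) ! i = cohomology_class B C (cochain_map B f \<phi>)"
      using xs by blast
    from vanishing_representative [OF f \<phi>(1) U [OF that]] \<phi>(2) show ?thesis
      by metis
  qed
  then obtain \<theta> where \<theta>: "\<And>i. i \<le> l \<Longrightarrow> \<theta> i \<in> rel_cocycles B C"
    "\<And>i. i \<le> l \<Longrightarrow> vanishes_on B (U i) (\<theta> i)"
    "\<And>i. i \<le> l \<Longrightarrow> (x # xs) ! i = cohomology_class B C (\<theta> i)"
    by metis
  \<comment> \<open>The head of the list is factor 0 and starts the fold; factors 1, ..., l form the
    tail. Thus l + 1 factors are matched with the l + 1 sets of the cover.\<close>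
  define \<psi>s where "\<psi>s = map (\<lambda>i. \<theta> (Suc i)) [0..<l]"
  have x: "x = cohomology_class B C (\<theta> 0)" and xs: "xs = map (cohomology_class B C) \<psi>s"
    using \<theta>(3) [of 0] \<theta>(3) [of "Suc i" for i] len by (auto simp: \<psi>s_def intro!: nth_equalityI)
  have cocycles: "\<theta> 0 \<in> rel_cocycles B C" "set \<psi>s \<subseteq> rel_cocycles B C"
    using \<theta>(1) by (auto simp: \<psi>s_def)
  have "foldl (cup B) (\<theta> 0) \<psi>s \<in> rel_coboundaries B C"
  proof (rule small_cocycle_imp_coboundary [where \<C> = "U ` {..l}"])
    show "foldl (cup B) (\<theta> 0) \<psi>s \<in> rel_cocycles B C"
      using cocycles by (rule rel_cocycles_foldl_cup)
    fix V
    assume "V \<in> U ` {..l}"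
    then obtain i where i: "i \<le> l" "V = U i"
      by auto
    have "\<theta> i \<in> set (\<theta> 0 # \<psi>s)"
      using i by (cases i) (auto simp: \<psi>s_def)
    then show "vanishes_on B V (foldl (cup B) (\<theta> 0) \<psi>s)"
      using \<theta>(2) i by (intro vanishes_on_foldl_cup) blast
  qed (use opn cover in auto)
  then show ?thesis
    using cohomology_class_foldl_mult [OF cocycles]
    by (simp add: x xs cohomology_class_coboundary)
qed

theorem theorem2p20:
  fixes B :: "'b topology" and C :: "'b set"
    and X :: "'a topology" and A :: "'a set"
    and f :: "'b \<Rightarrow> 'a"
  assumes "cw_pair B C" and "cw_pair X A"
    and "map_of_pairs B C X A f"
  shows "nilpotency_index
           (cohomology_image B C X A f :: ('b, 'r::{comm_ring,monoid_mult}) cochain set ring)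
         \<le> srelcat B C X A f"
  unfolding srelcat_def
\<comment> \<open>It suffices to bound the index by each admissible l; if there is none, the infimum
  of the empty set is \<infinity>.\<close>
proof (rule Inf_greatest, clarify)
  fix l and U :: "nat \<Rightarrow> 'b set"
  assume opn: "\<forall>i\<le>l. openin B (U i)" and cover: "(\<Union>i\<le>l. U i) = topspace B"
    and U: "\<forall>i\<le>l. strongly_relatively_inessential (subtopology B (U i)) (U i \<inter> C) X A f"
  let ?R = "cohomology_image B C X A f :: ('b, 'r) cochain set ring"
  let ?I = "rel_coboundaries B C :: ('b, 'r) cochain set"
  have carrier: "carrier ?R = cohomology_class B C ` cochain_map B f ` rel_cocycles X A"
    by (simp add: cohomology_image_def cohomology_ring_simps image_image cohomology_map_class [OF assms(3)])
  have mult: "(\<otimes>\<^bsub>?R\<^esub>) = (\<otimes>\<^bsub>cohomology_ring B C\<^esub>)" and add: "(\<oplus>\<^bsub>?R\<^esub>) = (\<oplus>\<^bsub>cohomology_ring B C\<^esub>)"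
    and zero: "\<zero>\<^bsub>?R\<^esub> = ?I"
    by (simp_all add: cohomology_image_def cohomology_ring_simps)
  have "(\<lambda>n \<sigma>. 0) \<in> rel_cocycles X A"
    by (simp add: rel_cocycles_iff rel_cochains_zero)
  then have zero_closed: "?I \<in> carrier ?R"
    unfolding carrier
    by (intro image_eqI [where x = "\<lambda>n \<sigma>. 0"]) (auto simp: cohomology_class_zero intro: image_eqI [where x = "\<lambda>n \<sigma>. 0"])
  have "ring_power ?R (l + 1) = {?I}"
    unfolding ring_power_def
  proof (rule generate_zero)
    show "?I = \<one>\<^bsub>add_monoid ?R\<^esub>" "?I \<in> carrier (add_monoid ?R)"
      by (simp_all add: zero zero_closed)
    show "?I \<otimes>\<^bsub>add_monoid ?R\<^esub> y = y" if "y \<in> carrier (add_monoid ?R)" for y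
      using that by (auto simp: add carrier zero_add_cohomology_class)
    show "{foldl (\<otimes>\<^bsub>?R\<^esub>) x xs |x xs. set (x # xs) \<subseteq> carrier ?R \<and> length (x # xs) = l + 1} \<subseteq> {?I}"
      unfolding mult carrier
      using cup_product_vanishes [OF assms(3) _ cover] opn U by blast
  qed
  then show "nilpotency_index ?R \<le> enat l"
    by (intro nilpotency_index_le) (simp add: zero)
qed

end
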